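(* Let $\omega$ be an open strict interval of $\mathbb T$ and let $T>0$. If $f_0\in L^2(\mathbb T)$ is analytic on $\mathbb T$ and $f_0\in \mathcal{NC}_{L^2}(\omega,T)$, then $f_0 = 0$.
   Context: $\mathbb T$ is the complex unit circle, identified with $\mathbb R/2\pi\mathbb Z$ via $x\mapsto e^{ix}$. An open strict interval of $\mathbb T$ is an open arc $\{e^{ix}:a<x<b\}$ with $0<b-a<2\pi$. Functions are complex valued; $f\in L^2(\mathbb T)$ is written $f(e^{ix})=\sum_{n\in\mathbb Z}\widehat f(n)e^{inx}$. "Analytic on $\mathbb T$" means extending holomorphically to a neighborhood of $\mathbb T$; equivalently $|\widehat f(n)|\le Ce^{-c|n|}$ for some $C,c>0$. Let $S(t)f(e^{ix})=\sum_{n}\widehat f(n)e^{-|n|t}e^{inx}$ (the semigroup generated by $-|D|$, $|D|f=\sum_n|n|\widehat f(n)e^{inx}$). The $L^2$ control system (half-heat equation) is $(\partial_t+|D|)f=\mathbf 1_\omega u$, $f(0,\cdot)=f_0\in L^2(\mathbb T)$, with control $u\in L^2([0,T]\times\omega)$; its solution satisfies $f(T,\cdot)=S(T)f_0+\int_0^TS(T-s)(\mathbf 1_\omega u(s,\cdot))\,ds$, where $\mathbf 1_\omega u$ is the extension of $u$ by $0$ outside $\omega$. $\mathcal{NC}_{L^2}(\omega,T)$ is the set of $f_0\in L^2(\mathbb T)$ for which there is $u\in L^2([0,T]\times\omega)$ with $f(T,\cdot)=0$. *)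

theory Defs
  imports "HOL-Analysis.Analysis"
begin

text \<open>
  The circle is \<^term>\<open>sphere (0::complex) 1\<close> and carries the image of the Lebesgue measure
  \<open>dx\<close> under \<open>x \<mapsto> e\<^sup>i\<^sup>x\<close> (total mass \<open>2\<pi>\<close>). Elements of \<open>L\<^sup>2\<close> are
  represented by Borel functions, and equality in \<open>L\<^sup>2\<close> is equality almost everywhere.
\<close>

definition circle :: "complex measure" where
  "circle = distr (restrict_space lborel {0..<2*pi}) (restrict_space borel (sphere 0 1)) cis"

definition L2 :: "'a measure \<Rightarrow> ('a \<Rightarrow> complex) set" where
  "L2 M = {f \<in> borel_measurable M. integrable M (\<lambda>x. (norm (f x))\<^sup>2)}"

definition open_strict_interval :: "complex set \<Rightarrow> bool" where
  "open_strict_interval \<omega> \<longleftrightarrow>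
     (\<exists>a b. 0 < b - a \<and> b - a < 2*pi \<and> \<omega> = cis ` {a<..<b})"

definition fourier_coeff :: "(complex \<Rightarrow> complex) \<Rightarrow> int \<Rightarrow> complex" where
  "fourier_coeff f n = (LINT z|circle. f z * z powi (-n)) / (2*pi)"

text \<open>
  An \<open>L\<^sup>2\<close> function is analytic on the circle if (a representative of) it extends
  holomorphically to a neighbourhood of the circle.
\<close>

definition analytic_on_circle :: "(complex \<Rightarrow> complex) \<Rightarrow> bool" where
  "analytic_on_circle f \<longleftrightarrow>
     (\<exists>U F. open U \<and> sphere 0 1 \<subseteq> U \<and> F holomorphic_on U \<and> (AE z in circle. f z = F z))"

text \<open>
  For \<open>t > 0\<close> and \<open>f \<in> L\<^sup>2\<close> the series converges absolutely at every point of the circle,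
  since the Fourier coefficients are bounded. At \<open>t = 0\<close> it would converge only in \<open>L\<^sup>2\<close>,
  with sum \<open>f\<close>, whence the case distinction.
\<close>

definition half_heat_semigroup :: "real \<Rightarrow> (complex \<Rightarrow> complex) \<Rightarrow> complex \<Rightarrow> complex" where
  "half_heat_semigroup t f z =
     (if t = 0 then f z
      else \<Sum>\<^sub>\<infinity>n::int. fourier_coeff f n * exp (- \<bar>real_of_int n\<bar> * t) * z powi n)"

definition extend_by_zero :: "'a set \<Rightarrow> ('a \<Rightarrow> complex) \<Rightarrow> 'a \<Rightarrow> complex" where
  "extend_by_zero A g z = (if z \<in> A then g z else 0)"

text \<open>
  Duhamel's formula for \<open>f (t, z)\<close>. If \<open>u \<in> L\<^sup>2([0,T] \<times> \<omega>)\<close> and \<open>0 \<le> t \<le> T\<close>, the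
  \<open>L\<^sup>2\<close>-valued integral over \<open>s\<close> can be computed pointwise: the integrand is jointly measurable
  in \<open>(s, z)\<close> off null sets, and by Minkowski's inequality and
  contractivity of the semigroup it is absolutely integrable in \<open>s\<close> for almost every \<open>z\<close>.
\<close>

definition half_heat_solution ::
  "complex set \<Rightarrow> (complex \<Rightarrow> complex) \<Rightarrow> (real \<times> complex \<Rightarrow> complex) \<Rightarrow> real \<Rightarrow> complex \<Rightarrow> complex"
  where
  "half_heat_solution \<omega> f\<^sub>0 u t z =
     half_heat_semigroup t f\<^sub>0 z +
     (LINT s:{0..t}|lborel.
        half_heat_semigroup (t - s) (extend_by_zero \<omega> (\<lambda>w. u (s, w))) z)"

definition null_controllable_L2 :: "complex set \<Rightarrow> real \<Rightarrow> (complex \<Rightarrow> complex) set" where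
  "null_controllable_L2 \<omega> T =
     {f\<^sub>0 \<in> L2 circle.
        \<exists>u \<in> L2 (restrict_space lborel {0..T} \<Otimes>\<^sub>M restrict_space circle \<omega>).
          AE z in circle. half_heat_solution \<omega> f\<^sub>0 u T z = 0}"

end

theory Submission
  imports Defs "HOL-Complex_Analysis.Complex_Analysis"
begin

text \<open>
  Taking Fourier coefficients in Duhamel's formula turns the control condition into
  \<open>2\<pi> \<cdot> fourier_coeff f\<^sub>0 n = - \<integral> u(s,w) e\<^bsup>|n|s\<^esup> w\<^bsup>-n\<^esup>\<close>, so for \<open>n \<ge> 0\<close> (and likewise for \<open>n \<le> 0\<close>)
  these coefficients are the moments \<open>a n = \<integral> \<zeta>\<^sup>n d\<nu>\<close> of a complex measure \<open>\<nu>\<close> on a truncated sector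
  \<open>K \<subseteq> {\<zeta>. 1 \<le> |\<zeta>| \<le> e\<^sup>T}\<close> whose directions avoid some point \<open>v\<close> of the circle.
  The function \<open>B(z) = \<integral> d\<nu>(\<zeta>) / (1 - z\<zeta>)\<close> is holomorphic off \<open>1/K\<close> and vanishes at infinity.
  Analyticity of \<open>f\<^sub>0\<close> makes \<open>A(z) = \<Sum>n. a n z\<^sup>n\<close> converge on a disc of radius greater than \<open>1\<close>.
  Both agree near \<open>0\<close>, hence, by continuation along the ray through the conjugate of \<open>v\<close>, also on an
  annulus outside the unit disc. They glue to an entire function vanishing at infinity, which is
  \<open>0\<close> by Liouville's theorem.
\<close>

section \<open>Moments of measures on a sector\<close>

text \<open>With \<open>h x = (w - w0) * \<phi> x / (1 - w0 * \<phi> x)\<close> one has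
  \<open>1 - w * \<phi> x = (1 - w0 * \<phi> x) * (1 - h x)\<close>. The bound
  \<open>\<epsilon>\<close> keeps \<open>norm (h x)\<close> below a fixed \<open>q < 1\<close>, so
  the geometric series can be integrated term by term. At \<open>w0 = 0\<close> the coefficients are
  the moments of \<open>\<phi>\<close> weighted by \<open>g\<close>.\<close>

lemma cauchy_transform_sums:
  fixes g \<phi> :: "'a \<Rightarrow> complex"
  assumes g: "integrable M g" and \<phi>[measurable]: "\<phi> \<in> borel_measurable M"
    and R: "R > 0" "\<And>x. x \<in> space M \<Longrightarrow> norm (\<phi> x) \<le> R"
    and \<epsilon>: "\<epsilon> > 0" "\<And>x. x \<in> space M \<Longrightarrow> \<epsilon> \<le> norm (1 - w0 * \<phi> x)"
    and w: "norm (w - w0) < \<epsilon> / R"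
  shows "(\<lambda>n. (LINT x|M. g x * \<phi> x ^ n / (1 - w0 * \<phi> x) ^ Suc n) * (w - w0) ^ n)
           sums (LINT x|M. g x / (1 - w * \<phi> x))"
proof -
  have [measurable]: "g \<in> borel_measurable M" using g by simp
  define f where "f n x = g x * \<phi> x ^ n / (1 - w0 * \<phi> x) ^ Suc n * (w - w0) ^ n" for n x
  define q where "q = norm (w - w0) * R / \<epsilon>"
  have q: "0 \<le> q" "q < 1"
    using w R(1) \<epsilon>(1) by (auto simp: q_def field_simps)
  define h where "h x = (w - w0) * \<phi> x / (1 - w0 * \<phi> x)" for x
  have hq: "norm (h x) \<le> q" if "x \<in> space M" for x
  proof -
    have "norm (w - w0) * norm (\<phi> x) / norm (1 - w0 * \<phi> x) \<le> norm (w - w0) * R / \<epsilon>"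
      using R(2)[OF that] \<epsilon>(2)[OF that] \<epsilon>(1) R(1)
      by (intro frac_le mult_left_mono) auto
    then show ?thesis by (simp add: h_def q_def norm_mult norm_divide)
  qed
  have fh: "f n x = g x / (1 - w0 * \<phi> x) * h x ^ n" for n x
    by (simp add: f_def h_def power_mult_distrib power_divide)
  have fb: "norm (f n x) \<le> (norm (g x) / \<epsilon>) * q ^ n" if "x \<in> space M" for n x
  proof -
    have "norm (h x) ^ n \<le> q ^ n" using hq[OF that] by (intro power_mono) auto
    moreover have "norm (g x) / norm (1 - w0 * \<phi> x) \<le> norm (g x) / \<epsilon>"
      using \<epsilon>(2)[OF that] \<epsilon>(1) by (intro divide_left_mono mult_pos_pos) auto
    ultimately show ?thesis
      unfolding fh norm_mult norm_divide norm_power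
      using \<epsilon>(1) by (intro mult_mono) auto
  qed
  have intb: "integrable M (\<lambda>x. (norm (g x) / \<epsilon>) * q ^ n)" for n
    using g by simp
  have intf: "integrable M (f n)" for n
  proof (rule Bochner_Integration.integrable_bound[OF intb[of n]])
    show "f n \<in> borel_measurable M" unfolding f_def[abs_def] by measurable
  qed (use fb q \<epsilon>(1) in \<open>auto simp: abs_mult\<close>)
  have "(\<lambda>n. integral\<^sup>L M (f n)) sums (LINT x|M. (\<Sum>n. f n x))"
  proof (rule sums_integral[OF intf])
    show "AE x in M. summable (\<lambda>i. norm (f i x))"
    proof (rule AE_I2)
      fix x assume x: "x \<in> space M"
      show "summable (\<lambda>i. norm (f i x))"
        by (rule summable_comparison_test'[where g="\<lambda>n. (norm (g x) / \<epsilon>) * q ^ n" and N=0])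
          (use fb[OF x] q in \<open>auto intro!: summable_mult summable_geometric\<close>)
    qed
    show "summable (\<lambda>i. LINT x|M. norm (f i x))"
    proof (rule summable_comparison_test'[where g="\<lambda>n. (LINT x|M. norm (g x) / \<epsilon>) * q ^ n" and N=0])
      show "summable (\<lambda>n. (LINT x|M. norm (g x) / \<epsilon>) * q ^ n)"
        using q by (auto intro!: summable_mult summable_geometric)
      fix n
      have "(LINT x|M. norm (f n x)) \<le> (LINT x|M. (norm (g x) / \<epsilon>) * q ^ n)"
        by (rule integral_mono[OF integrable_norm[OF intf] intb fb])
      then show "norm (LINT x|M. norm (f n x)) \<le> (LINT x|M. norm (g x) / \<epsilon>) * q ^ n"
        by simp
    qed
  qed
  moreover have "(LINT x|M. (\<Sum>n. f n x)) = (LINT x|M. g x / (1 - w * \<phi> x))"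
  proof (rule Bochner_Integration.integral_cong[OF refl])
    fix x assume x: "x \<in> space M"
    have h1: "norm (h x) < 1" using hq[OF x] q by simp
    have ne: "1 - w0 * \<phi> x \<noteq> 0" using \<epsilon>(1) \<epsilon>(2)[OF x] by auto
    have "(\<lambda>n. f n x) sums (g x / (1 - w0 * \<phi> x) * (1 / (1 - h x)))"
      unfolding fh using geometric_sums[OF h1] by (rule sums_mult)
    moreover have "(1 - w0 * \<phi> x) * (1 - h x) = 1 - w * \<phi> x"
      using ne by (simp add: h_def field_simps)
    then have "g x / (1 - w0 * \<phi> x) * (1 / (1 - h x)) = g x / (1 - w * \<phi> x)"
      by simp
    ultimately show "(\<Sum>n. f n x) = g x / (1 - w * \<phi> x)" by (simp add: sums_iff)
  qed
  moreover have "integral\<^sup>L M (f n) =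
      (LINT x|M. g x * \<phi> x ^ n / (1 - w0 * \<phi> x) ^ Suc n) * (w - w0) ^ n" for n
    unfolding f_def by (rule integral_mult_left_zero)
  ultimately show ?thesis by simp
qed

text \<open>\<open>\<Omega>\<close> asks for a uniform lower bound on
  \<open>norm (1 - w * \<phi> x)\<close> and not just for nonvanishing, since the values of
  \<open>\<phi>\<close> need not form a closed set. The bound yields a power series around each
  point of \<open>\<Omega>\<close>, hence holomorphy.\<close>

lemma cauchy_transform_holomorphic:
  fixes g \<phi> :: "'a \<Rightarrow> complex"
  assumes g: "integrable M g" and \<phi>: "\<phi> \<in> borel_measurable M"
    and R: "R > 0" "\<And>x. x \<in> space M \<Longrightarrow> norm (\<phi> x) \<le> R"
  defines "\<Omega> \<equiv> {w. \<exists>\<epsilon>>0. \<forall>x\<in>space M. \<epsilon> \<le> norm (1 - w * \<phi> x)}"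
  shows "open \<Omega>" and "(\<lambda>w. LINT x|M. g x / (1 - w * \<phi> x)) holomorphic_on \<Omega>"
proof -
  have *: "\<exists>r>0. ball w0 r \<subseteq> \<Omega> \<and> (\<lambda>w. LINT x|M. g x / (1 - w * \<phi> x)) holomorphic_on ball w0 r"
    if w0: "w0 \<in> \<Omega>" for w0
  proof -
    obtain \<epsilon> where \<epsilon>: "\<epsilon> > 0" "\<And>x. x \<in> space M \<Longrightarrow> \<epsilon> \<le> norm (1 - w0 * \<phi> x)"
      using w0 unfolding \<Omega>_def by auto
    \<comment> \<open>Half of the radius \<open>\<epsilon> / R\<close> from the expansion: on this
      ball the lower bound drops at most to \<open>\<epsilon> / 2\<close>, so the same ball also
      proves \<open>\<Omega>\<close> open.\<close>
    have "(\<lambda>w. LINT x|M. g x / (1 - w * \<phi> x)) holomorphic_on ball w0 (\<epsilon> / (2 * R))"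
    proof (rule power_series_holomorphic)
      fix w assume "w \<in> ball w0 (\<epsilon> / (2 * R))"
      then have "norm (w - w0) < \<epsilon> / (2 * R)" by (simp add: dist_norm norm_minus_commute)
      also have "\<dots> \<le> \<epsilon> / R" using \<epsilon>(1) R(1) by (simp add: field_simps)
      finally show "(\<lambda>n. (LINT x|M. g x * \<phi> x ^ n / (1 - w0 * \<phi> x) ^ Suc n) * (w - w0) ^ n)
           sums (LINT x|M. g x / (1 - w * \<phi> x))"
        by (intro cauchy_transform_sums[OF g \<phi> R \<epsilon>])
    qed
    moreover have "ball w0 (\<epsilon> / (2 * R)) \<subseteq> \<Omega>"
    proof
      fix w assume "w \<in> ball w0 (\<epsilon> / (2 * R))"
      then have w: "norm (w - w0) < \<epsilon> / (2 * R)" by (simp add: dist_norm norm_minus_commute)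
      have "\<epsilon> / 2 \<le> norm (1 - w * \<phi> x)" if x: "x \<in> space M" for x
      proof -
        have "norm ((w - w0) * \<phi> x) \<le> \<epsilon> / (2 * R) * R"
          unfolding norm_mult using w R(1) R(2)[OF x] \<epsilon>(1) by (intro mult_mono) auto
        then have "norm ((w - w0) * \<phi> x) \<le> \<epsilon> / 2" using R(1) by simp
        moreover have "norm (1 - w0 * \<phi> x) \<le> norm (1 - w * \<phi> x) + norm ((w - w0) * \<phi> x)"
          using norm_triangle_ineq[of "1 - w * \<phi> x" "(w - w0) * \<phi> x"] by (simp add: algebra_simps)
        ultimately show ?thesis using \<epsilon>(2)[OF x] by linarith
      qed
      then show "w \<in> \<Omega>" unfolding \<Omega>_def using \<epsilon>(1) by (auto intro!: exI[of _ "\<epsilon> / 2"])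
    qed
    ultimately show ?thesis using \<epsilon>(1) R(1) by (intro exI[of _ "\<epsilon> / (2 * R)"]) auto
  qed
  show op: "open \<Omega>" unfolding open_contains_ball using * by blast
  show "(\<lambda>w. LINT x|M. g x / (1 - w * \<phi> x)) holomorphic_on \<Omega>"
    unfolding holomorphic_on_def
  proof
    fix w assume "w \<in> \<Omega>"
    from *[OF this] show "(\<lambda>w. LINT x|M. g x / (1 - w * \<phi> x)) field_differentiable at w within \<Omega>"
      by (meson centre_in_ball field_differentiable_at_within holomorphic_on_imp_differentiable_at open_ball)
  qed
qed

text \<open>If \<open>\<rho> * \<tau>\<close> is close to \<open>1\<close>, then
  \<open>\<rho>\<close> is equally close to \<open>1\<close>, so \<open>\<tau>\<close> is close to
  \<open>\<rho> * \<tau>\<close> and hence to \<open>1\<close>. The bound does not depend on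
  \<open>\<rho>\<close>, so it serves a whole ray at once.\<close>

lemma norm_one_minus_ray_ge:
  fixes \<tau> :: complex
  assumes "norm \<tau> = 1" "\<rho> \<ge> 0"
  shows "norm (1 - \<tau>) / 2 \<le> norm (1 - of_real \<rho> * \<tau>)"
proof -
  have "norm (1 - \<tau>) \<le> norm (1 - of_real \<rho> * \<tau>) + norm (of_real \<rho> * \<tau> - \<tau>)"
    using norm_triangle_ineq[of "1 - of_real \<rho> * \<tau>" "of_real \<rho> * \<tau> - \<tau>"] by simp
  moreover have "norm (of_real \<rho> * \<tau> - \<tau>) = \<bar>\<rho> - 1\<bar>"
  proof -
    have "of_real \<rho> * \<tau> - \<tau> = of_real (\<rho> - 1) * \<tau>" by (simp add: algebra_simps)
    then show ?thesis using assms(1) by (metis mult.right_neutral norm_mult norm_of_real)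
  qed
  moreover have "\<bar>\<rho> - 1\<bar> \<le> norm (1 - of_real \<rho> * \<tau>)"
    using norm_triangle_ineq3[of 1 "of_real \<rho> * \<tau>"] assms by (simp add: norm_mult)
  ultimately show ?thesis by linarith
qed

text \<open>Here the complex measure \<open>\<nu>\<close> is the image under \<open>\<phi>\<close>
  of the measure with density \<open>g\<close>. The decay with \<open>q < 1\<close> is what
  analyticity provides. The direction \<open>v\<close>, kept clear of the values of
  \<open>\<phi>\<close>, leaves a path from \<open>0\<close> out of the unit disc on which the
  Cauchy transform is holomorphic.\<close>

lemma moments_eq_0:
  fixes g \<phi> :: "'a \<Rightarrow> complex"
  assumes g: "integrable M g" and \<phi>: "\<phi> \<in> borel_measurable M"
    and \<phi>1: "\<And>x. x \<in> space M \<Longrightarrow> 1 \<le> norm (\<phi> x)"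
    and R: "\<And>x. x \<in> space M \<Longrightarrow> norm (\<phi> x) \<le> R"
    and v: "norm v = 1" "\<delta> > 0" "\<And>x. x \<in> space M \<Longrightarrow> \<delta> \<le> norm (sgn (\<phi> x) - v)"
    and q: "0 < q" "q < 1" "\<And>n. norm (LINT x|M. g x * \<phi> x ^ n) \<le> C * q ^ n"
  shows "(LINT x|M. g x * \<phi> x ^ n) = 0"
\<comment> \<open>Only a point of the space forces \<open>R > 0\<close>, through
  \<open>1 \<le> norm (\<phi> x) \<le> R\<close>.\<close>
proof (cases "space M = {}")
  case True
  then show ?thesis by (subst Bochner_Integration.integral_cong[of M M _ "\<lambda>_. 0"]) auto
next
  case False
  then have R0: "R > 0" using \<phi>1 R by (meson all_not_in_conv less_le_trans order_trans zero_less_one)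
  define a where "a n = (LINT x|M. g x * \<phi> x ^ n)" for n
  define B where "B w = (LINT x|M. g x / (1 - w * \<phi> x))" for w
  define \<Omega> where "\<Omega> = {w. \<exists>\<epsilon>>0. \<forall>x\<in>space M. \<epsilon> \<le> norm (1 - w * \<phi> x)}"
  have \<Omega>: "open \<Omega>" and B: "B holomorphic_on \<Omega>"
    unfolding \<Omega>_def B_def using cauchy_transform_holomorphic[OF g \<phi> R0 R] by blast+
  define A where "A w = (\<Sum>n. a n * w ^ n)" for w
  define D where "D = ball (0::complex) (1 / q)"
  have Asums: "(\<lambda>n. a n * (w - 0) ^ n) sums A w" if "w \<in> D" for w
  proof -
    have wq: "q * norm w < 1" using that q(1) by (simp add: D_def field_simps)
    have "summable (\<lambda>n. a n * w ^ n)"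
    proof (rule summable_comparison_test'[where g="\<lambda>n. C * (q * norm w) ^ n" and N=0])
      show "summable (\<lambda>n. C * (q * norm w) ^ n)"
        using wq q by (intro summable_mult summable_geometric) auto
      fix n
      show "norm (a n * w ^ n) \<le> C * (q * norm w) ^ n"
        using mult_right_mono[OF q(3)[of n], of "norm w ^ n"]
        by (simp add: a_def norm_mult norm_power power_mult_distrib mult_ac)
    qed
    then show ?thesis by (simp add: A_def summable_sums)
  qed
  have A: "A holomorphic_on D"
    unfolding D_def using Asums unfolding D_def by (rule power_series_holomorphic)
  have near0: "A w = B w" if "norm w < 1 / R" for w
  proof -
    have "(\<lambda>n. a n * (w - 0) ^ n) sums B w"
      using cauchy_transform_sums[OF g \<phi> R0 R, of 1 0 w] that by (simp add: a_def B_def)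
    then show ?thesis by (simp add: A_def sums_iff)
  qed
  have out: "w \<in> \<Omega>" if "norm w > 1" for w
    unfolding \<Omega>_def
  proof (intro CollectI exI[of _ "norm w - 1"] conjI ballI)
    fix x assume x: "x \<in> space M"
    have "norm w \<le> norm (w * \<phi> x)"
      using mult_left_mono[OF \<phi>1[OF x], of "norm w"] by (simp add: norm_mult)
    then show "norm w - 1 \<le> norm (1 - w * \<phi> x)"
      using norm_triangle_ineq3[of 1 "w * \<phi> x"] by simp
  qed (use that in auto)
  \<comment> \<open>Multiplication by \<open>v\<close> turns the distance of
    \<open>cnj v * sgn (\<phi> x)\<close> from \<open>1\<close> into that of
    \<open>sgn (\<phi> x)\<close> from \<open>v\<close>, which is at least \<open>\<delta>\<close>.
    Scaling by \<open>r * norm (\<phi> x)\<close> loses at most a factor of two.\<close>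
  have ray: "of_real r * cnj v \<in> \<Omega>" if "r \<ge> 0" for r
    unfolding \<Omega>_def
  proof (intro CollectI exI[of _ "\<delta> / 2"] conjI ballI)
    fix x assume x: "x \<in> space M"
    have n: "norm (\<phi> x) \<noteq> 0" using \<phi>1[OF x] by auto
    then have s: "norm (sgn (\<phi> x)) = 1" by (simp add: norm_sgn)
    have vv: "v * cnj v = 1" using v(1) by (simp add: complex_mult_cnj cmod_def)
    have "norm (1 - cnj v * sgn (\<phi> x)) = norm (v * (1 - cnj v * sgn (\<phi> x)))"
      unfolding norm_mult[of v] using v(1) by simp
    also have "v * (1 - cnj v * sgn (\<phi> x)) = v - sgn (\<phi> x)"
      using vv by (simp add: algebra_simps flip: mult.assoc)
    finally have "\<delta> / 2 \<le> norm (1 - cnj v * sgn (\<phi> x)) / 2"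
      using v(3)[OF x] by (simp add: norm_minus_commute)
    also have "\<dots> \<le> norm (1 - of_real (r * norm (\<phi> x)) * (cnj v * sgn (\<phi> x)))"
      using that v(1) s by (intro norm_one_minus_ray_ge) (auto simp: norm_mult)
    also have "of_real (r * norm (\<phi> x)) * (cnj v * sgn (\<phi> x)) = of_real r * cnj v * \<phi> x"
      using n by (simp add: sgn_div_norm scaleR_conv_of_real field_simps)
    finally show "\<delta> / 2 \<le> norm (1 - of_real r * cnj v * \<phi> x)" .
  qed (use v in auto)
  \<comment> \<open>\<open>A\<close> and \<open>B\<close> are known to agree only near
    \<open>0\<close>, and \<open>\<Omega> \<inter> D\<close> need not be connected. The identity
    theorem is therefore applied on the component of \<open>0\<close>, which is then shown to
    contain the ray and the annulus.\<close>
  define W where "W = connected_component_set (\<Omega> \<inter> D) 0"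
  have W: "open W" "connected W" "W \<subseteq> \<Omega> \<inter> D"
    unfolding W_def using \<Omega> connected_component_subset[of "\<Omega> \<inter> D" 0]
    by (simp_all add: D_def open_connected_component open_Int)
  have zero: "0 \<in> \<Omega> \<inter> D" using ray[of 0] q by (auto simp: D_def)
  have AB: "A w = B w" if "w \<in> W" for w
  proof (rule analytic_continuation_open[of "W \<inter> ball 0 (1 / R)" W A B])
    have "0 \<in> W" unfolding W_def using zero by (simp add: connected_component_refl)
    then show "W \<inter> ball 0 (1 / R) \<noteq> {}" using R0 by force
  qed (use W A B that near0 in \<open>auto intro: holomorphic_on_subset\<close>)
  have seg: "of_real r * cnj v \<in> W" if "0 \<le> r" "r < 1 / q" for r
  proof -
    have "(\<lambda>r. of_real r * cnj v) ` {0..<1/q} \<subseteq> W"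
      unfolding W_def
    proof (rule connected_component_maximal)
      show "connected ((\<lambda>r. of_real r * cnj v) ` {0..<1/q})"
        by (intro connected_continuous_image continuous_intros connected_Ico)
      show "0 \<in> (\<lambda>r. of_real r * cnj v) ` {0..<1/q}" using q by (intro image_eqI[of _ _ 0]) auto
      show "(\<lambda>r. of_real r * cnj v) ` {0..<1/q} \<subseteq> \<Omega> \<inter> D"
        using ray v(1) by (auto simp: D_def norm_mult)
    qed
    then show ?thesis using that by (simp add: image_subset_iff)
  qed
  have q1: "1 < 1 / q" using q by simp
  \<comment> \<open>The annulus is connected, lies in \<open>\<Omega> \<inter> D\<close>, and meets
    the ray at any radius \<open>r\<close> strictly between \<open>1\<close> and
    \<open>1 / q\<close>, so it belongs to the same component.\<close>
  have ann: "{w. 1 < norm w \<and> norm w < 1 / q} \<subseteq> W"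
  proof -
    obtain r where r: "1 < r" "r < 1 / q" using dense[OF q1] by auto
    have eq: "connected_component_set (\<Omega> \<inter> D) 0 = connected_component_set (\<Omega> \<inter> D) (of_real r * cnj v)"
      using seg[of r] r by (intro connected_component_eq[symmetric]) (auto simp: W_def)
    show ?thesis
      unfolding W_def eq
    proof (rule connected_component_maximal)
      show "connected {w::complex. 1 < norm w \<and> norm w < 1 / q}"
        using connected_annulus(1)[of 1 "0::complex" "1/q"] by simp
    qed (use r v(1) out in \<open>auto simp: D_def norm_mult\<close>)
  qed
  \<comment> \<open>The two domains \<open>D\<close> and the exterior of the closed unit disc cover
    the plane because \<open>1 / q > 1\<close>. They overlap exactly in the annulus, where
    \<open>A\<close> and \<open>B\<close> agree.\<close>
  define E where "E w = (if w \<in> D then A w else B w)" for w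
  have "E holomorphic_on (D \<union> - cball 0 1)"
    unfolding E_def
  proof (rule holomorphic_on_If_Un)
    show "B holomorphic_on - cball 0 1" by (rule holomorphic_on_subset[OF B]) (use out in auto)
    show "A w = B w" if "w \<in> D" "w \<in> - cball 0 1" for w
      using that ann by (intro AB) (auto simp: D_def)
  qed (use A in \<open>auto simp: D_def\<close>)
  moreover have "D \<union> - cball 0 1 = UNIV" using q1 by (auto simp: D_def)
  ultimately have E: "E holomorphic_on UNIV" by simp
  \<comment> \<open>Outside \<open>D\<close> the function is \<open>B\<close>, and
    \<open>norm (\<phi> x) \<ge> 1\<close> gives
    \<open>norm (1 - w * \<phi> x) \<ge> norm w - 1\<close>.\<close>
  have "(E \<longlongrightarrow> 0) at_infinity"
  proof (rule Lim_null_comparison)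
    define K where "K = (LINT x|M. norm (g x))"
    show "\<forall>\<^sub>F w in at_infinity. norm (E w) \<le> K * inverse (norm w - 1)"
      unfolding eventually_at_infinity
    proof (intro exI[of _ "1 / q"] allI impI)
      fix w :: complex assume w: "1 / q \<le> norm w"
      then have w1: "norm w > 1" using q1 by linarith
      have "norm (E w) = norm (B w)" using w by (simp add: E_def D_def)
      also have "\<dots> \<le> (LINT x|M. norm (g x) * inverse (norm w - 1))"
        unfolding B_def
      proof (rule order_trans[OF integral_norm_bound integral_mono])
        show int: "integrable M (\<lambda>x. norm (g x) * inverse (norm w - 1))" using g by simp
        have bd: "norm (g x / (1 - w * \<phi> x)) \<le> norm (g x) * inverse (norm w - 1)"
          if x: "x \<in> space M" for x
        proof -
          have "norm w \<le> norm (w * \<phi> x)"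
            using mult_left_mono[OF \<phi>1[OF x], of "norm w"] by (simp add: norm_mult)
          then have "norm w - 1 \<le> norm (1 - w * \<phi> x)"
            using norm_triangle_ineq3[of 1 "w * \<phi> x"] by simp
          then show ?thesis
            unfolding norm_divide unfolding divide_inverse using w1
            by (intro mult_left_mono le_imp_inverse_le) auto
        qed
        then show "\<And>x. x \<in> space M \<Longrightarrow> norm (g x / (1 - w * \<phi> x)) \<le> norm (g x) * inverse (norm w - 1)" .
        show "integrable M (\<lambda>x. norm (g x / (1 - w * \<phi> x)))"
          by (rule integrable_norm, rule Bochner_Integration.integrable_bound[OF int])
            (use bd w1 g \<phi> in \<open>auto simp: abs_mult\<close>)
      qed
      also have "\<dots> = K * inverse (norm w - 1)" by (simp add: K_def)
      finally show "norm (E w) \<le> K * inverse (norm w - 1)" .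
    qed
    have "filterlim (\<lambda>w::complex. - 1 + norm w) at_top at_infinity"
      by (rule filterlim_tendsto_add_at_top[OF tendsto_const filterlim_norm_at_top])
    then have "((\<lambda>w::complex. inverse (norm w - 1)) \<longlongrightarrow> 0) at_infinity"
      using filterlim_compose[OF tendsto_inverse_0_at_top, of "\<lambda>w::complex. - 1 + norm w"]
      by (simp add: tendsto_inverse_0_at_top)
    then show "((\<lambda>w::complex. K * inverse (norm w - 1)) \<longlongrightarrow> 0) at_infinity"
      by (rule tendsto_mult_right_zero)
  qed
  then have E0: "E w = 0" for w by (rule Liouville_weak_0[OF E])
  have A0: "(\<lambda>n. a n * (w - 0) ^ n) sums 0" if "w \<in> D" for w
    using Asums[OF that] E0[of w] that by (simp add: E_def)
  show ?thesis
  proof (rule ccontr)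
    assume "(LINT x|M. g x * \<phi> x ^ n) \<noteq> 0"
    then have an: "a n \<noteq> 0" by (simp add: a_def)
    \<comment> \<open>The nonvanishing result for power series wants a nonzero coefficient of
      positive index, so the constant term is read off at \<open>0\<close> first.\<close>
    have "0 \<in> D" using zero by simp
    from A0[OF this] have "a 0 = 0" by simp
    then have "n > 0" using an by (cases n) auto
    with an obtain s where s: "0 < s" "\<And>z. z \<in> cball (0::complex) s - {0} \<Longrightarrow> (\<lambda>_. 0::complex) z \<noteq> 0"
      using powser_0_nonzero[of "1/q" 0 a "\<lambda>_. 0" n] A0 q by (auto simp: D_def)
    from s(2)[of "of_real s"] s(1) show False by simp
  qed
qed

section \<open>Integration over the circle\<close>

lemma space_circle [simp]: "space circle = sphere 0 1"
  by (simp add: circle_def space_restrict_space)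

lemma sets_circle [measurable_cong]: "sets circle = sets (restrict_space borel (sphere 0 1))"
  by (simp add: circle_def)

lemma measurable_cis_circle [measurable]:
  "cis \<in> restrict_space lborel {0..<2*pi} \<rightarrow>\<^sub>M restrict_space borel (sphere 0 1)"
proof (rule measurable_restrict_space2)
  have "cis \<in> borel_measurable borel"
    by (intro borel_measurable_continuous_onI continuous_intros)
  then show "cis \<in> borel_measurable (restrict_space lborel {0..<2*pi})"
    by (intro measurable_restrict_space1) simp
qed auto

lemma finite_measure_circle: "finite_measure circle"
proof -
  have "finite_measure (restrict_space lborel {0..<2*pi})"
    by (rule finite_measureI) (simp add: emeasure_restrict_space space_restrict_space)
  then show ?thesis
    unfolding circle_def by (rule finite_measure.finite_measure_distr) simp
qed

interpretation circle: finite_measure circle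
  by (rule finite_measure_circle)

lemma borel_measurable_circle_continuous:
  fixes f :: "complex \<Rightarrow> 'b::topological_space"
  assumes "continuous_on (sphere 0 1) f"
  shows "f \<in> borel_measurable circle"
  using borel_measurable_continuous_on_restrict[OF assms]
  by (simp add: measurable_cong_sets[OF sets_circle refl])

lemma borel_measurable_circle_id [measurable]: "(\<lambda>z. z) \<in> borel_measurable circle"
  by (intro borel_measurable_circle_continuous continuous_intros)

lemma borel_measurable_power_int [measurable (raw)]:
  fixes f :: "'a \<Rightarrow> complex"
  assumes [measurable]: "f \<in> borel_measurable M"
  shows "(\<lambda>x. f x powi n) \<in> borel_measurable M"
  by (cases "n \<ge> 0") (simp_all add: power_int_def)

lemma integral_circle_eq_set_integral:
  fixes f :: "complex \<Rightarrow> complex"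
  assumes "f \<in> borel_measurable circle"
  shows "(LINT z|circle. f z) = (LINT x:{0..<2*pi}|lborel. f (cis x))"
proof -
  have f: "f \<in> borel_measurable (restrict_space borel (sphere 0 1))"
    using assms by (simp add: measurable_cong_sets[OF sets_circle refl])
  show ?thesis
    unfolding circle_def set_lebesgue_integral_def
    by (simp add: integral_distr[OF measurable_cis_circle f] integral_restrict_space)
qed

text \<open>Passes to the gauge integral, for which the fundamental theorem of calculus and the
  parametrised contour integrals are available. The endpoint \<open>2*pi\<close> that closes the
  interval is negligible.\<close>

lemma integral_circle_continuous:
  fixes f :: "complex \<Rightarrow> complex"
  assumes f: "continuous_on (sphere 0 1) f"
  shows "(LINT z|circle. f z) = integral {0..2*pi} (\<lambda>x. f (cis x))"
proof -
  have c: "continuous_on {0..2*pi} (\<lambda>x. f (cis x))"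
    by (intro continuous_on_compose2[OF f] continuous_intros) auto
  have "set_integrable lborel {0..2*pi} (\<lambda>x. f (cis x))"
    by (rule borel_integrable_compact[OF compact_Icc c, folded set_integrable_def])
  then have "set_integrable lborel {0..<2*pi} (\<lambda>x. f (cis x))"
    by (rule set_integrable_subset) auto
  then have "(LINT x:{0..<2*pi}|lborel. f (cis x)) = integral {0..<2*pi} (\<lambda>x. f (cis x))"
    by (rule set_borel_integral_eq_integral)
  also have "\<dots> = integral {0..2*pi} (\<lambda>x. f (cis x))"
    by (rule integral_subset_negligible)
      (auto intro: negligible_subset[of "{2*pi}"])
  finally show ?thesis
    using integral_circle_eq_set_integral[OF borel_measurable_circle_continuous[OF f]] by simp
qed

lemma integrable_circle_continuous:
  fixes f :: "complex \<Rightarrow> complex"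
  assumes f: "continuous_on (sphere 0 1) f"
  shows "integrable circle f"
proof -
  have "bounded (f ` sphere 0 1)"
    by (intro compact_imp_bounded compact_continuous_image f) simp
  then obtain B where "\<forall>z\<in>sphere 0 1. norm (f z) \<le> B" by (auto simp: bounded_iff)
  then show ?thesis
    by (intro circle.integrable_const_bound[of _ B] AE_I2)
      (auto intro: borel_measurable_circle_continuous f)
qed

lemma continuous_on_sphere_power_int:
  "continuous_on (sphere 0 1) (\<lambda>z::complex. z powi n)"
  by (intro continuous_intros) auto

text \<open>Orthogonality of the characters: for \<open>n \<noteq> 0\<close> the antiderivative
  \<open>cis x powi n / (\<i> * of_int n)\<close> is periodic, so its values at \<open>0\<close> and
  \<open>2*pi\<close> cancel.\<close>

lemma integral_circle_power_int:
  "(LINT z|circle. z powi n) = (if n = 0 then 2 * of_real pi else 0)"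
proof -
  have "(LINT z|circle. z powi n) = integral {0..2*pi} (\<lambda>x. cis x powi n)"
    by (rule integral_circle_continuous[OF continuous_on_sphere_power_int])
  also have "\<dots> = (if n = 0 then 2 * of_real pi else 0)"
  proof (cases "n = 0")
    case False
    have "((\<lambda>x. cis x powi n) has_integral
        (cis (2*pi) powi n / (\<i> * of_int n) - cis 0 powi n / (\<i> * of_int n))) {0..2*pi}"
    proof (rule fundamental_theorem_of_calculus)
      fix x :: real
      have "((\<lambda>x. exp (\<i> * of_real (of_int n * x)) / (\<i> * of_int n)) has_vector_derivative
          exp (\<i> * of_real (of_int n * x))) (at x within {0..2*pi})"
        using False
        by (auto intro!: derivative_eq_intros has_vector_derivative_real_field) (simp add: mult_ac)
      then show "((\<lambda>x. cis x powi n / (\<i> * of_int n)) has_vector_derivative cis x powi n)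
          (at x within {0..2*pi})"
        unfolding cis_power_int by (simp add: cis_conv_exp)
    qed simp
    then show ?thesis using False by (simp add: integral_unique)
  qed (simp add: scaleR_conv_of_real)
  finally show ?thesis .
qed

text \<open>Termwise integration is known for sequences, so the integers are enumerated by
  \<open>int_decode\<close>. Unordered summation demands absolute convergence; the majorant, split
  into a summable factor \<open>b\<close> and an integrable factor \<open>h\<close>, provides it
  both pointwise and for the integrals.\<close>

lemma has_sum_integral_int:
  fixes f :: "int \<Rightarrow> 'a \<Rightarrow> complex"
  assumes int: "\<And>i. integrable M (f i)"
    and bd: "\<And>i x. x \<in> space M \<Longrightarrow> norm (f i x) \<le> b i * h x"
    and h: "integrable M h" and b: "b summable_on UNIV" "\<And>i. 0 \<le> b i"
  shows "((\<lambda>i. integral\<^sup>L M (f i)) has_sum (LINT x|M. (\<Sum>\<^sub>\<infinity>i. f i x))) UNIV"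
proof -
  define d where "d = int_decode"
  have d: "bij_betw d UNIV UNIV" unfolding d_def by (rule bij_int_decode)
  have "(\<lambda>n. b (d n)) summable_on UNIV"
    using summable_on_reindex_bij_betw[OF d, of b] b by simp
  then have sb: "summable (\<lambda>n. b (d n))"
    by (rule summable_on_imp_summable)
  have sf: "summable (\<lambda>n. norm (f (d n) x))" if x: "x \<in> space M" for x
    by (rule summable_comparison_test'[where g="\<lambda>n. b (d n) * h x" and N=0])
      (use sb bd[OF x] in \<open>auto intro: summable_mult2\<close>)
  have le: "(LINT x|M. norm (f (d n) x)) \<le> b (d n) * (LINT x|M. h x)" for n
    using integral_mono[OF integrable_norm[OF int] integrable_mult_right[OF h, of "b (d n)"] bd]
    by simp
  have sif: "summable (\<lambda>n. LINT x|M. norm (f (d n) x))"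
    by (rule summable_comparison_test'[where g="\<lambda>n. b (d n) * (LINT x|M. h x)" and N=0])
      (use sb le in \<open>auto intro: summable_mult2\<close>)
  have "summable (\<lambda>n. norm (integral\<^sup>L M (f (d n))))"
    by (rule summable_comparison_test'[OF sif]) simp
  moreover have "(\<lambda>n. integral\<^sup>L M (f (d n))) sums (LINT x|M. (\<Sum>n. f (d n) x))"
    by (intro sums_integral int AE_I2 sf sif)
  ultimately have "((\<lambda>n. integral\<^sup>L M (f (d n))) has_sum (LINT x|M. (\<Sum>n. f (d n) x))) UNIV"
    by (rule norm_summable_imp_has_sum)
  then have "((\<lambda>i. integral\<^sup>L M (f i)) has_sum (LINT x|M. (\<Sum>n. f (d n) x))) UNIV"
    using has_sum_reindex_bij_betw[OF d, of "\<lambda>i. integral\<^sup>L M (f i)"] by simp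
  also have "(LINT x|M. (\<Sum>n. f (d n) x)) = (LINT x|M. (\<Sum>\<^sub>\<infinity>i. f i x))"
  proof (rule Bochner_Integration.integral_cong[OF refl])
    fix x assume x: "x \<in> space M"
    have "((\<lambda>n. f (d n) x) has_sum (\<Sum>n. f (d n) x)) UNIV"
      by (rule norm_summable_imp_has_sum[OF sf[OF x] summable_sums[OF summable_norm_cancel[OF sf[OF x]]]])
    then have "((\<lambda>i. f i x) has_sum (\<Sum>n. f (d n) x)) UNIV"
      using has_sum_reindex_bij_betw[OF d, of "\<lambda>i. f i x"] by simp
    then show "(\<Sum>n. f (d n) x) = (\<Sum>\<^sub>\<infinity>i. f i x)"
      by (rule infsumI[symmetric])
  qed
  finally show ?thesis .
qed

section \<open>The Poisson kernel\<close>

text \<open>The numerator vanishes at \<open>r = 1\<close>, so the value there is \<open>0\<close>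
  for every \<open>z\<close>, even for \<open>z = 1\<close>, where the denominator vanishes too.
  This radius occurs at the final time of the control.\<close>

definition poisson_kernel :: "real \<Rightarrow> complex \<Rightarrow> real" where
  "poisson_kernel r z = (1 - r\<^sup>2) / (norm (1 - of_real r * z))\<^sup>2"

lemma poisson_kernel_nonneg: "0 \<le> r \<Longrightarrow> r \<le> 1 \<Longrightarrow> 0 \<le> poisson_kernel r z"
  by (simp add: poisson_kernel_def power_le_one)

lemma poisson_kernel_1 [simp]: "poisson_kernel 1 z = 0"
  by (simp add: poisson_kernel_def)

lemma has_sum_int_halves:
  fixes f :: "int \<Rightarrow> 'a::{topological_comm_monoid_add,t2_space}"
  assumes "((\<lambda>n. f (int n)) has_sum a) UNIV" "((\<lambda>n. f (- int (Suc n))) has_sum b) UNIV"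
  shows "(f has_sum (a + b)) UNIV"
proof -
  have "(f has_sum a) (range int)"
    using assms(1) by (subst has_sum_reindex) (auto simp: o_def)
  moreover have "(f has_sum b) (range (\<lambda>n. - int (Suc n)))"
    using assms(2) by (subst has_sum_reindex) (auto simp: o_def inj_on_def)
  moreover have "range int \<inter> range (\<lambda>n. - int (Suc n)) = {}" by auto
  ultimately have "(f has_sum (a + b)) (range int \<union> range (\<lambda>n. - int (Suc n)))"
    by (rule has_sum_Un_disjoint)
  moreover have "i \<in> range int \<union> range (\<lambda>n. - int (Suc n))" for i
    by (cases i rule: int_cases) auto
  then have "range int \<union> range (\<lambda>n. - int (Suc n)) = UNIV" by blast
  ultimately show ?thesis by simp
qed

text \<open>Two geometric series: on the unit circle negative powers of \<open>z\<close> are powers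
  of \<open>cnj z\<close>. The negative half starts at exponent one, whence its additional factor
  \<open>of_real r * cnj z\<close>.\<close>

lemma poisson_kernel_has_sum:
  assumes z: "norm z = 1" and r: "0 \<le> r" "r < 1"
  shows "((\<lambda>n::int. of_real (r ^ nat \<bar>n\<bar>) * z powi n) has_sum of_real (poisson_kernel r z)) UNIV"
proof -
  have zc: "z * cnj z = 1" using z by (metis complex_norm_square of_real_1 power_one)
  then have z0: "z \<noteq> 0" "inverse z = cnj z" by (auto intro: inverse_unique)
  have n1: "norm (of_real r * z) < 1" "norm (of_real r * cnj z) < 1"
    using z r by (auto simp: norm_mult)
  have ne: "1 - of_real r * z \<noteq> 0" "1 - of_real r * cnj z \<noteq> 0" using n1 by auto
  have geo: "((\<lambda>n. c ^ n) has_sum (1 / (1 - c))) UNIV" if "norm c < 1" for c :: complex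
  proof (rule norm_summable_imp_has_sum[OF _ geometric_sums[OF that]])
    show "summable (\<lambda>n. norm (c ^ n))"
      unfolding norm_power using that by (intro summable_geometric) simp
  qed
  have "((\<lambda>n. (of_real r * z) ^ n) has_sum (1 / (1 - of_real r * z))) UNIV"
    by (rule geo[OF n1(1)])
  then have a: "((\<lambda>n. of_real (r ^ nat \<bar>int n\<bar>) * z powi int n) has_sum (1 / (1 - of_real r * z))) UNIV"
    unfolding power_mult_distrib by simp
  have "((\<lambda>n. of_real r * cnj z * (of_real r * cnj z) ^ n) has_sum
      (of_real r * cnj z * (1 / (1 - of_real r * cnj z)))) UNIV"
    by (rule has_sum_cmult_right[OF geo[OF n1(2)]])
  moreover have "of_real (r ^ nat \<bar>- int (Suc n)\<bar>) * z powi (- int (Suc n)) =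
      of_real r * cnj z * (of_real r * cnj z) ^ n" for n
  proof -
    have "nat \<bar>- int (Suc n)\<bar> = Suc n" by simp
    moreover have "z powi (- int (Suc n)) = cnj z ^ Suc n"
      unfolding power_int_minus power_int_of_nat z0(2)[symmetric] by (simp add: power_inverse)
    ultimately show ?thesis by (simp add: power_mult_distrib)
  qed
  ultimately have b: "((\<lambda>n. of_real (r ^ nat \<bar>- int (Suc n)\<bar>) * z powi (- int (Suc n))) has_sum
      (of_real r * cnj z * (1 / (1 - of_real r * cnj z)))) UNIV"
    by simp
  have "1 / (1 - of_real r * z) + of_real r * cnj z * (1 / (1 - of_real r * cnj z)) =
      (1 - of_real r ^ 2 * (z * cnj z)) / ((1 - of_real r * z) * (1 - of_real r * cnj z))"
    using ne by (simp add: divide_simps) (simp add: algebra_simps power2_eq_square)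
  also have "(1 - of_real r * z) * (1 - of_real r * cnj z) = of_real ((norm (1 - of_real r * z))\<^sup>2)"
    unfolding complex_norm_square by simp
  also have "(1 - of_real r ^ 2 * (z * cnj z)) / of_real ((norm (1 - of_real r * z))\<^sup>2) =
      of_real (poisson_kernel r z)"
    by (simp add: poisson_kernel_def zc)
  finally show ?thesis using has_sum_int_halves[where f = "\<lambda>n. of_real (r ^ nat \<bar>n\<bar>) * z powi n", OF a b] by simp
qed

lemma summable_on_power_abs_int:
  fixes r :: real
  assumes "0 \<le> r" "r < 1"
  shows "(\<lambda>n::int. r ^ nat \<bar>n\<bar>) summable_on UNIV"
proof -
  have "((\<lambda>n::int. complex_of_real (r ^ nat \<bar>n\<bar>)) has_sum of_real (poisson_kernel r 1)) UNIV"
    using poisson_kernel_has_sum[of 1 r] assms by simp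
  then show ?thesis by (auto simp only: has_sum_of_real_iff has_sum_imp_summable)
qed

lemma poisson_kernel_pos:
  assumes "0 \<le> r" "r < 1" "norm z = 1"
  shows "0 < poisson_kernel r z"
proof -
  have "norm (of_real r * z) < 1" using assms by (simp add: norm_mult)
  then have "1 - of_real r * z \<noteq> 0" by auto
  moreover have "r\<^sup>2 < 1" using assms by (simp add: power_less_one_iff abs_square_less_1)
  ultimately show ?thesis by (simp add: poisson_kernel_def)
qed

lemma continuous_on_poisson_kernel [continuous_intros]:
  assumes "0 \<le> r" "r < 1" "continuous_on S f" "\<And>x. x \<in> S \<Longrightarrow> norm (f x) = 1"
  shows "continuous_on S (\<lambda>x. poisson_kernel r (f x))"
proof -
  have "1 - of_real r * f x \<noteq> 0" if "x \<in> S" for x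
  proof -
    have "norm (of_real r * f x) < 1" using assms that by (simp add: norm_mult)
    then show ?thesis by auto
  qed
  then show ?thesis
    unfolding poisson_kernel_def by (intro continuous_intros assms(3)) auto
qed

lemma borel_measurable_poisson_kernel [measurable (raw)]:
  assumes [measurable]: "r \<in> borel_measurable M" "f \<in> borel_measurable M"
  shows "(\<lambda>x. poisson_kernel (r x) (f x)) \<in> borel_measurable M"
  unfolding poisson_kernel_def by measurable

section \<open>The semigroup as a Poisson integral\<close>

lemma integrable_circle_mult_continuous:
  fixes f g :: "complex \<Rightarrow> complex"
  assumes f: "integrable circle f" and g: "continuous_on (sphere 0 1) g"
  shows "integrable circle (\<lambda>z. f z * g z)"
proof -
  have "bounded (g ` sphere 0 1)"
    by (intro compact_imp_bounded compact_continuous_image g) simp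
  then obtain B where B: "\<And>z. z \<in> sphere 0 1 \<Longrightarrow> norm (g z) \<le> B"
    by (meson bounded_iff imageI)
  have [measurable]: "f \<in> borel_measurable circle" "g \<in> borel_measurable circle"
    using f borel_measurable_circle_continuous[OF g] by auto
  have "integrable circle (\<lambda>z. norm (f z) * B)" using f by simp
  then show ?thesis
  proof (rule Bochner_Integration.integrable_bound)
    show "AE z in circle. norm (f z * g z) \<le> norm (norm (f z) * B)"
    proof (rule AE_I2)
      fix z assume "z \<in> space circle"
      then have "norm (g z) \<le> \<bar>B\<bar>" using B[of z] by auto
      then show "norm (f z * g z) \<le> norm (norm (f z) * B)"
        by (auto simp: norm_mult abs_mult intro: mult_left_mono)
    qed
  qed measurable
qed

text \<open>The reciprocal of a nonvanishing continuous factor is continuous, so the factor can be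
  removed again. Thus a function that is not integrable stays so after multiplication by a character
  or by a Poisson kernel of radius below \<open>1\<close>.\<close>

lemma integrable_circle_mult_continuous_iff:
  fixes f g :: "complex \<Rightarrow> complex"
  assumes g: "continuous_on (sphere 0 1) g" and nz: "\<And>z. norm z = 1 \<Longrightarrow> g z \<noteq> 0"
  shows "integrable circle (\<lambda>z. f z * g z) \<longleftrightarrow> integrable circle f"
proof
  assume "integrable circle (\<lambda>z. f z * g z)"
  then have "integrable circle (\<lambda>z. f z * g z * inverse (g z))"
    by (rule integrable_circle_mult_continuous) (use nz in \<open>auto intro!: continuous_intros g\<close>)
  also have "?this \<longleftrightarrow> integrable circle f"
    by (rule Bochner_Integration.integrable_cong) (use nz in auto)
  finally show "integrable circle f" .
qed (rule integrable_circle_mult_continuous[OF _ g])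

text \<open>
  If \<open>g\<close> is not integrable, then neither are the integrands on both sides, which are therefore
  zero. Dropping the integrability of \<open>g\<close> gives the measurability in time of Duhamel's integrand.
\<close>

lemma half_heat_semigroup_eq_poisson_integral:
  assumes t: "t > 0" and z: "norm z = 1"
  shows "half_heat_semigroup t g z =
    (LINT w|circle. g w * of_real (poisson_kernel (exp (-t)) (z / w))) / (2 * pi)"
proof -
  define r where "r = exp (-t)"
  have r: "0 \<le> r" "r < 1" using t by (auto simp: r_def)
  have P: "continuous_on (sphere 0 1) (\<lambda>w. complex_of_real (poisson_kernel r (z / w)))"
    using r z by (intro continuous_intros) (auto simp: norm_divide)
  have e: "complex_of_real (exp (- \<bar>real_of_int n\<bar> * t)) = of_real (r ^ nat \<bar>n\<bar>)" for n
  proof -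
    have "real (nat \<bar>n\<bar>) = \<bar>real_of_int n\<bar>" by simp
    then show ?thesis unfolding r_def exp_of_nat_mult[symmetric] by simp
  qed
  show ?thesis
  proof (cases "integrable circle g")
    case True
    \<comment> \<open>The terms of the expanded Poisson kernel: \<open>(z / w) powi n\<close>
      separates into \<open>z powi n\<close> and \<open>w powi (- n)\<close>, and the latter
      integrates against \<open>g\<close> to the Fourier coefficient.\<close>
    define f where "f n w = g w * (of_real (r ^ nat \<bar>n\<bar>) * (z / w) powi n)" for n w
    have fint: "integrable circle (f n)" for n
      unfolding f_def
      by (intro integrable_circle_mult_continuous True continuous_intros) (use z in auto)
    have "((\<lambda>n. integral\<^sup>L circle (f n)) has_sum (LINT w|circle. (\<Sum>\<^sub>\<infinity>n. f n w))) UNIV"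
    proof (rule has_sum_integral_int[OF fint])
      show "integrable circle (\<lambda>w. norm (g w))" using True by simp
      show "norm (f n w) \<le> r ^ nat \<bar>n\<bar> * norm (g w)" if "w \<in> space circle" for n w
        using that z r by (simp add: f_def norm_mult norm_divide norm_power_int norm_power)
    qed (use r in \<open>auto intro: summable_on_power_abs_int\<close>)
    also have "(LINT w|circle. (\<Sum>\<^sub>\<infinity>n. f n w)) =
        (LINT w|circle. g w * of_real (poisson_kernel r (z / w)))"
    proof (rule Bochner_Integration.integral_cong[OF refl])
      fix w assume "w \<in> space circle"
      then have "norm (z / w) = 1" using z by (simp add: norm_divide)
      from has_sum_cmult_right[OF poisson_kernel_has_sum[OF this r]]
      show "(\<Sum>\<^sub>\<infinity>n. f n w) = g w * of_real (poisson_kernel r (z / w))"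
        unfolding f_def by (rule infsumI)
    qed
    finally have hs: "((\<lambda>n. integral\<^sup>L circle (f n)) has_sum
        (LINT w|circle. g w * of_real (poisson_kernel r (z / w)))) UNIV" .
    have "integral\<^sup>L circle (f n) / (2 * pi) = fourier_coeff g n * of_real (r ^ nat \<bar>n\<bar>) * z powi n" for n
    proof -
      have "integral\<^sup>L circle (f n) =
          (LINT w|circle. g w * w powi (- n) * (of_real (r ^ nat \<bar>n\<bar>) * z powi n))"
        unfolding f_def
        by (intro Bochner_Integration.integral_cong refl)
          (simp add: power_int_divide_distrib power_int_minus field_simps)
      also have "\<dots> = (LINT w|circle. g w * w powi (- n)) * (of_real (r ^ nat \<bar>n\<bar>) * z powi n)"
        by (rule integral_mult_left_zero)
      finally show ?thesis by (simp add: fourier_coeff_def)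
    qed
    moreover have "((\<lambda>n. integral\<^sup>L circle (f n) / (2 * pi)) has_sum
        (LINT w|circle. g w * of_real (poisson_kernel r (z / w))) / (2 * pi)) UNIV"
      by (rule has_sum_divide_const[OF hs])
    ultimately have "((\<lambda>n. fourier_coeff g n * of_real (r ^ nat \<bar>n\<bar>) * z powi n) has_sum
        (LINT w|circle. g w * of_real (poisson_kernel r (z / w))) / (2 * pi)) UNIV"
      by simp
    then show ?thesis
      unfolding half_heat_semigroup_def e r_def[symmetric] using t by (simp add: infsumI)
  next
    case False
    have "fourier_coeff g n = 0" for n
    proof -
      have "integrable circle (\<lambda>z. g z * z powi (- n)) \<longleftrightarrow> integrable circle g"
        by (rule integrable_circle_mult_continuous_iff[OF continuous_on_sphere_power_int]) auto
      then show ?thesis using False by (simp add: fourier_coeff_def not_integrable_integral_eq)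
    qed
    moreover have "(LINT w|circle. g w * of_real (poisson_kernel r (z / w))) = 0"
    proof (rule not_integrable_integral_eq)
      have "poisson_kernel r (z / w) \<noteq> 0" if "norm w = 1" for w
        using poisson_kernel_pos[OF r, of "z / w"] z that by (simp add: norm_divide)
      then show "\<not> integrable circle (\<lambda>w. g w * of_real (poisson_kernel r (z / w)))"
        using integrable_circle_mult_continuous_iff[OF P, of g] False by auto
    qed
    ultimately show ?thesis
      using t by (simp add: half_heat_semigroup_def flip: r_def)
  qed
qed

text \<open>Orthogonality leaves only the term with index \<open>n\<close> of the expanded kernel.
  This expresses that convolution with the kernel multiplies the coefficient of index
  \<open>n\<close> by \<open>r ^ nat \<bar>n\<bar>\<close>, up to the factor
  \<open>2 * pi\<close>.\<close>

lemma integral_power_int_poisson_kernel: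
  fixes w :: complex
  assumes w: "norm w = 1" and r: "0 \<le> r" "r < 1"
  shows "(LINT z|circle. z powi (- n) * of_real (poisson_kernel r (z / w))) =
    of_real (2 * pi * r ^ nat \<bar>n\<bar>) * w powi (- n)"
proof -
  have w0: "w \<noteq> 0" using w by auto
  define f where "f i z = z powi (- n) * (of_real (r ^ nat \<bar>i\<bar>) * (z / w) powi i)" for i z
  have "((\<lambda>i. integral\<^sup>L circle (f i)) has_sum (LINT z|circle. (\<Sum>\<^sub>\<infinity>i. f i z))) UNIV"
  proof (rule has_sum_integral_int)
    show "integrable circle (f i)" for i
      unfolding f_def by (intro integrable_circle_continuous continuous_intros) (use w0 in auto)
    show "integrable circle (\<lambda>_. 1::real)" by simp
    show "norm (f i z) \<le> r ^ nat \<bar>i\<bar> * 1" if "z \<in> space circle" for i z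
      using that w r by (simp add: f_def norm_mult norm_divide norm_power_int norm_power)
  qed (use r in \<open>auto intro: summable_on_power_abs_int\<close>)
  also have "(LINT z|circle. (\<Sum>\<^sub>\<infinity>i. f i z)) =
      (LINT z|circle. z powi (- n) * of_real (poisson_kernel r (z / w)))"
  proof (rule Bochner_Integration.integral_cong[OF refl])
    fix z assume "z \<in> space circle"
    then have "norm (z / w) = 1" using w by (simp add: norm_divide)
    from has_sum_cmult_right[OF poisson_kernel_has_sum[OF this r]]
    show "(\<Sum>\<^sub>\<infinity>i. f i z) = z powi (- n) * of_real (poisson_kernel r (z / w))"
      unfolding f_def by (rule infsumI)
  qed
  finally have "((\<lambda>i. integral\<^sup>L circle (f i)) has_sum
      (LINT z|circle. z powi (- n) * of_real (poisson_kernel r (z / w)))) UNIV" .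
  moreover have fi: "integral\<^sup>L circle (f i) =
      (if i = n then of_real (2 * pi * r ^ nat \<bar>n\<bar>) * w powi (- n) else 0)" for i
  proof -
    have "integral\<^sup>L circle (f i) = (LINT z|circle. of_real (r ^ nat \<bar>i\<bar>) * w powi (- i) * z powi (i - n))"
    proof (rule Bochner_Integration.integral_cong[OF refl])
      fix z assume "z \<in> space circle"
      then have "z \<noteq> 0" by auto
      then have "z powi (i - n) = z powi i * z powi (- n)"
        by (simp add: power_int_diff power_int_minus divide_inverse)
      then show "f i z = of_real (r ^ nat \<bar>i\<bar>) * w powi (- i) * z powi (i - n)"
        unfolding f_def power_int_divide_distrib by (simp add: power_int_minus divide_inverse mult_ac)
    qed
    also have "\<dots> = of_real (r ^ nat \<bar>i\<bar>) * w powi (- i) * (LINT z|circle. z powi (i - n))"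
      by (rule integral_mult_right_zero)
    also have "\<dots> = (if i = n then of_real (2 * pi * r ^ nat \<bar>n\<bar>) * w powi (- n) else 0)"
      by (simp add: integral_circle_power_int)
    finally show ?thesis .
  qed
  moreover have "((\<lambda>i. integral\<^sup>L circle (f i)) has_sum
      (of_real (2 * pi * r ^ nat \<bar>n\<bar>) * w powi (- n))) UNIV"
    by (rule has_sum_finite_neutralI[of "{n}"]) (auto simp: fi)
  ultimately show ?thesis by (blast intro: has_sum_unique)
qed

lemma integral_poisson_kernel:
  fixes w :: complex
  assumes w: "norm w = 1" and r: "0 \<le> r" "r < 1"
  shows "(LINT z|circle. poisson_kernel r (z / w)) = 2 * pi"
proof -
  have "complex_of_real (LINT z|circle. poisson_kernel r (z / w)) = of_real (2 * pi)"
    using integral_power_int_poisson_kernel[OF assms, of 0] by simp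
  then show ?thesis by (simp only: of_real_eq_iff)
qed

text \<open>The integral of a function that is not integrable is \<open>0\<close> by convention,
  whereas this one is \<open>2 * pi\<close>.\<close>

lemma integrable_poisson_kernel:
  fixes w :: complex
  assumes w: "norm w = 1" and r: "0 \<le> r" "r < 1"
  shows "integrable circle (\<lambda>z. poisson_kernel r (z / w))"
  using not_integrable_integral_eq[of circle "\<lambda>z. poisson_kernel r (z / w)"]
    integral_poisson_kernel[OF assms] by auto

text \<open>Fubini's theorem: the kernel is nonnegative with mass \<open>2 * pi\<close> in
  \<open>z\<close> for every radius below \<open>1\<close>, so \<open>2 * pi * norm (g p)\<close>
  dominates even when \<open>r p\<close> comes close to \<open>1\<close>. At \<open>r p = 1\<close>
  the kernel is \<open>0\<close>, whence the truncation of \<open>g\<close> on the right. A general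
  \<open>N\<close> covers both the initial state, with \<open>N = circle\<close>, and the control,
  with \<open>N\<close> the space-time strip.\<close>

lemma
  fixes g w :: "'a \<Rightarrow> complex"
  assumes "sigma_finite_measure N" and g: "integrable N g"
    and [measurable]: "w \<in> borel_measurable N" "r \<in> borel_measurable N"
    and w: "\<And>p. p \<in> space N \<Longrightarrow> norm (w p) = 1"
    and r: "\<And>p. p \<in> space N \<Longrightarrow> 0 \<le> r p \<and> r p \<le> 1"
  shows integrable_poisson_kernel_pair:
      "integrable (N \<Otimes>\<^sub>M circle) (\<lambda>(p, z). z powi (- n) * (g p * of_real (poisson_kernel (r p) (z / w p))))"
        (is "integrable _ ?K")
    and fourier_integral_poisson:
      "(LINT z|circle. z powi (- n) * (LINT p|N. g p * of_real (poisson_kernel (r p) (z / w p)))) =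
       (LINT p|N. (if r p < 1 then g p else 0) * (of_real (2 * pi * r p ^ nat \<bar>n\<bar>) * w p powi (- n)))"
proof -
  interpret N: sigma_finite_measure N by fact
  interpret pair_sigma_finite N circle ..
  have [measurable]: "g \<in> borel_measurable N" using g by simp
  have K: "?K \<in> borel_measurable (N \<Otimes>\<^sub>M circle)" by measurable
  have normK: "(LINT z|circle. norm (?K (p, z))) = (if r p < 1 then norm (g p) * (2 * pi) else 0)"
    if p: "p \<in> space N" for p
  proof -
    have "(LINT z|circle. norm (?K (p, z))) = (LINT z|circle. norm (g p) * poisson_kernel (r p) (z / w p))"
      by (intro Bochner_Integration.integral_cong refl)
        (use r[OF p] in \<open>auto simp: norm_mult norm_power_int poisson_kernel_nonneg\<close>)
    also have "\<dots> = norm (g p) * (LINT z|circle. poisson_kernel (r p) (z / w p))"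
      by (rule integral_mult_right_zero)
    also have "\<dots> = (if r p < 1 then norm (g p) * (2 * pi) else 0)"
      using r[OF p] integral_poisson_kernel[OF w[OF p], of "r p"]
      by (cases "r p < 1") (auto simp: not_less dest: antisym)
    finally show ?thesis .
  qed
  show int: "integrable (N \<Otimes>\<^sub>M circle) ?K"
  proof (rule Fubini_integrable[OF K])
    have "integrable N (\<lambda>p. norm (g p) * (2 * pi))" using g by simp
    then show "integrable N (\<lambda>p. LINT z|circle. norm (?K (p, z)))"
    proof (rule Bochner_Integration.integrable_bound)
      show "AE p in N. norm (LINT z|circle. norm (?K (p, z))) \<le> norm (norm (g p) * (2 * pi))"
        using normK by (intro AE_I2) simp
      show "(\<lambda>p. LINT z|circle. norm (?K (p, z))) \<in> borel_measurable N"
        using K by measurable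
    qed
    show "AE p in N. integrable circle (\<lambda>z. ?K (p, z))"
    proof (rule AE_I2)
      fix p assume p: "p \<in> space N"
      show "integrable circle (\<lambda>z. ?K (p, z))"
      proof (cases "r p < 1")
        case True
        then have "integrable circle (\<lambda>z. complex_of_real (poisson_kernel (r p) (z / w p)) * (z powi (- n) * g p))"
          using r[OF p] w[OF p]
          by (intro integrable_circle_mult_continuous continuous_on_sphere_power_int continuous_on_mult
              continuous_on_const integrable_of_real integrable_poisson_kernel) auto
        then show ?thesis by (simp add: mult_ac)
      next
        case False
        then have "r p = 1" using r[OF p] by auto
        then show ?thesis by simp
      qed
    qed
  qed
  have "(LINT z|circle. z powi (- n) * (LINT p|N. g p * of_real (poisson_kernel (r p) (z / w p)))) =
      (LINT z|circle. (LINT p|N. ?K (p, z)))"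
    by simp
  also have "\<dots> = (LINT p|N. (LINT z|circle. ?K (p, z)))"
    using Fubini_integral[of "\<lambda>p z. ?K (p, z)"] int by simp
  also have "\<dots> = (LINT p|N. (if r p < 1 then g p else 0) *
      (of_real (2 * pi * r p ^ nat \<bar>n\<bar>) * w p powi (- n)))"
  proof (rule Bochner_Integration.integral_cong[OF refl])
    fix p assume p: "p \<in> space N"
    have "(LINT z|circle. ?K (p, z)) =
        (LINT z|circle. g p * (z powi (- n) * of_real (poisson_kernel (r p) (z / w p))))"
      by (simp add: mult_ac)
    also have "\<dots> = g p * (LINT z|circle. z powi (- n) * of_real (poisson_kernel (r p) (z / w p)))"
      by (rule integral_mult_right_zero)
    also have "\<dots> = (if r p < 1 then g p else 0) * (of_real (2 * pi * r p ^ nat \<bar>n\<bar>) * w p powi (- n))"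
      using r[OF p] integral_power_int_poisson_kernel[OF w[OF p], of "r p" n]
      by (cases "r p < 1") (auto simp: not_less dest: antisym)
    finally show "(LINT z|circle. ?K (p, z)) = \<dots>" .
  qed
  finally show "(LINT z|circle. z powi (- n) * (LINT p|N. g p * of_real (poisson_kernel (r p) (z / w p)))) =
       (LINT p|N. (if r p < 1 then g p else 0) * (of_real (2 * pi * r p ^ nat \<bar>n\<bar>) * w p powi (- n)))" .
qed

section \<open>Fourier coefficients of analytic and continuous functions\<close>

text \<open>On the unit circle \<open>dz\<close> is \<open>\<i> * z\<close> times
  \<open>dx\<close>.\<close>

lemma contour_integral_circlepath_eq_circle:
  assumes h: "continuous_on (sphere 0 1) h"
  shows "contour_integral (circlepath 0 1) h = \<i> * (LINT z|circle. h z * z)"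
proof -
  have "contour_integral (circlepath 0 1) h = integral {0..2*pi} (\<lambda>t. h (cis t) * \<i> * cis t)"
    unfolding circlepath_def
    by (subst contour_integral_part_circlepath_eq) simp_all
  also have "\<dots> = integral {0..2*pi} (\<lambda>t. \<i> * (h (cis t) * cis t))"
    by (simp add: mult_ac)
  also have "\<dots> = \<i> * integral {0..2*pi} (\<lambda>t. h (cis t) * cis t)"
    by (rule integral_mult_right)
  also have "integral {0..2*pi} (\<lambda>t. h (cis t) * cis t) = (LINT z|circle. h z * z)"
    by (rule integral_circle_continuous[symmetric]) (intro continuous_intros h)
  finally show ?thesis .
qed

text \<open>The contour is moved radially from the unit circle to the circle of radius
  \<open>r\<close>, where the integrand is estimated directly. For decay, \<open>r > 1\<close> is
  the useful choice for positive \<open>n\<close> and \<open>r < 1\<close> for negative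
  \<open>n\<close>.\<close>

lemma norm_circle_integral_le:
  assumes U: "open U" "F holomorphic_on U" and r: "r > 0"
    and sub: "\<And>z. norm z = 1 \<Longrightarrow> closed_segment z (of_real r * z) \<subseteq> U"
    and B: "\<And>z. norm z = r \<Longrightarrow> norm (F z) \<le> B"
  shows "norm (LINT z|circle. F z * z powi (- n)) \<le> 2 * pi * B * r powi (- n)"
proof -
  \<comment> \<open>The exponent is lowered by one because \<open>dz\<close> contributes a factor
    \<open>z\<close>.\<close>
  define h where "h z = F z * z powi (- n - 1)" for z
  have sphU: "sphere 0 1 \<subseteq> U" using sub by force
  have h: "h holomorphic_on (U - {0})"
    unfolding h_def by (intro holomorphic_intros holomorphic_on_subset[OF U(2)]) auto
  \<comment> \<open>\<open>h\<close> may be singular at \<open>0\<close>, so the homotopy has to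
    avoid that point. It does, since each segment stays on the open ray through
    \<open>z\<close>.\<close>
  have seg0: "0 \<notin> closed_segment z (of_real r * z)" if z: "norm z = 1" for z :: complex
  proof
    assume "0 \<in> closed_segment z (of_real r * z)"
    then obtain u where u: "0 \<le> u" "u \<le> 1" "0 = (1 - u) *\<^sub>R z + u *\<^sub>R (of_real r * z)"
      by (auto simp: closed_segment_def)
    have "0 = of_real ((1 - u) + u * r) * z" using u(3) by (simp add: scaleR_conv_of_real algebra_simps)
    moreover have "z \<noteq> 0" using z by auto
    ultimately have "(1 - u) + u * r = 0" by (metis mult_eq_0_iff of_real_eq_0_iff)
    moreover have "u * r \<ge> 0" using u r by simp
    ultimately have "u = 1" "u * r = 0" using u by linarith+
    then show False using r by simp
  qed
  have hom: "homotopic_loops (U - {0}) (circlepath 0 1) (circlepath 0 r)"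
  proof (rule homotopic_loops_linear)
    fix t :: real
    have "norm (circlepath 0 1 t) = 1" by (simp add: circlepath)
    moreover have "circlepath 0 r t = of_real r * circlepath 0 1 t" by (simp add: circlepath)
    ultimately show "closed_segment (circlepath 0 1 t) (circlepath 0 r t) \<subseteq> U - {0}"
      using sub seg0 by (metis Diff_empty subset_Diff_insert)
  qed auto
  have imU: "sphere 0 r \<subseteq> U - {0}"
  proof
    fix z :: complex assume z: "z \<in> sphere 0 r"
    have "z = of_real r * (z / of_real r)" "norm (z / of_real r) = 1"
      using r z by (auto simp: norm_divide)
    then show "z \<in> U - {0}" using sub[of "z / of_real r"] r z by fastforce
  qed
  have hcont: "continuous_on (sphere 0 1) h"
    using sphU by (intro holomorphic_on_imp_continuous_on holomorphic_on_subset[OF h]) auto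
  have "(LINT z|circle. F z * z powi (- n)) = (LINT z|circle. h z * z)"
  proof (rule Bochner_Integration.integral_cong[OF refl])
    fix z assume "z \<in> space circle"
    then have "z \<noteq> 0" by auto
    then have "z powi (- n) = z powi (- n - 1) * z"
      using power_int_add_1[of z "- n - 1"] by simp
    then show "F z * z powi (- n) = h z * z" by (simp add: h_def)
  qed
  then have "norm (LINT z|circle. F z * z powi (- n)) = norm (contour_integral (circlepath 0 1) h)"
    unfolding contour_integral_circlepath_eq_circle[OF hcont] by (simp add: norm_mult)
  also have "contour_integral (circlepath 0 1) h = contour_integral (circlepath 0 r) h"
    by (rule Cauchy_theorem_homotopic_loops[OF hom _ h]) (use U in auto)
  also have "norm \<dots> \<le> (B * r powi (- n - 1)) * (2 * pi * r)"
  proof (rule has_contour_integral_bound_circlepath)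
    have "h contour_integrable_on circlepath 0 r"
      using imU r by (intro contour_integrable_continuous_circlepath
          holomorphic_on_imp_continuous_on holomorphic_on_subset[OF h]) auto
    then show "(h has_contour_integral contour_integral (circlepath 0 r) h) (circlepath 0 r)"
      by (rule has_contour_integral_integral)
    have B0: "0 \<le> B" using order_trans[OF norm_ge_zero B[of "of_real r"]] r by simp
    then show "0 \<le> B * r powi (- n - 1)" using r by simp
    show "norm (h z) \<le> B * r powi (- n - 1)" if "norm (z - 0) = r" for z
      unfolding h_def norm_mult norm_power_int using that B[of z] B0 r by (intro mult_mono) simp_all
  qed (use r in auto)
  also have "(B * r powi (- n - 1)) * (2 * pi * r) = 2 * pi * B * r powi (- n)"
    using power_int_add_1[of r "- n - 1"] r by simp
  finally show ?thesis .
qed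

text \<open>By compactness the neighbourhood contains a closed annulus around the circle, and
  contours can be moved to both of its boundary circles. The extension is returned as well: it is a
  continuous representative of \<open>f\<close>, to which uniqueness of Fourier coefficients will be
  applied.\<close>

lemma fourier_coeff_exponential_decay:
  assumes "analytic_on_circle f" and f: "f \<in> borel_measurable circle"
  obtains F where "continuous_on (sphere 0 1) F" "AE z in circle. f z = F z"
    and "\<exists>C q. 0 < q \<and> q < 1 \<and> (\<forall>n. norm (fourier_coeff f n) \<le> C * q ^ nat \<bar>n\<bar>)"
proof -
  obtain U F where U: "open U" "sphere 0 1 \<subseteq> U" "F holomorphic_on U" and ae: "AE z in circle. f z = F z"
    using assms(1) unfolding analytic_on_circle_def by blast
  have Fc: "continuous_on (sphere 0 1) F"
    using U by (intro holomorphic_on_imp_continuous_on holomorphic_on_subset[OF U(3)])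
  obtain \<epsilon>0 where \<epsilon>0: "\<epsilon>0 > 0" "(\<Union>x\<in>sphere (0::complex) 1. cball x \<epsilon>0) \<subseteq> U"
    using compact_subset_open_imp_cball_epsilon_subset[OF compact_sphere U(1,2)] by blast
  \<comment> \<open>The cap \<open>1/2\<close> keeps the inner radius \<open>1 - \<epsilon>\<close>
    positive.\<close>
  define \<epsilon> where "\<epsilon> = min \<epsilon>0 (1/2)"
  have \<epsilon>: "0 < \<epsilon>" "\<epsilon> < 1" "\<epsilon> \<le> \<epsilon>0" using \<epsilon>0 by (auto simp: \<epsilon>_def)
  have seg: "closed_segment z (of_real r * z) \<subseteq> U" if z: "norm z = 1" and r: "\<bar>r - 1\<bar> \<le> \<epsilon>" for z r
  proof -
    have "norm (of_real r * z - z) = norm (of_real (r - 1) * z)" by (simp add: left_diff_distrib)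
    also have "\<dots> = \<bar>r - 1\<bar>" unfolding norm_mult norm_of_real by (simp add: z)
    finally have "dist z (of_real r * z) \<le> \<epsilon>0"
      using r \<epsilon>(3) by (simp add: dist_norm norm_minus_commute)
    then have "closed_segment z (of_real r * z) \<subseteq> cball z \<epsilon>0"
      using \<epsilon>0 by (intro closed_segment_subset) auto
    moreover have "cball z \<epsilon>0 \<subseteq> U"
    proof -
      have "z \<in> sphere 0 1" using z by simp
      then show ?thesis using \<epsilon>0(2) by blast
    qed
    ultimately show ?thesis by (rule subset_trans)
  qed
  have sph: "compact (F ` sphere 0 r)" if r: "r > 0" "\<bar>r - 1\<bar> \<le> \<epsilon>" for r
  proof (intro compact_continuous_image holomorphic_on_imp_continuous_on holomorphic_on_subset[OF U(3)])
    show "sphere 0 r \<subseteq> U"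
    proof
      fix z :: complex assume z: "z \<in> sphere 0 r"
      have "z = of_real r * (z / of_real r)" "norm (z / of_real r) = 1"
        using r z by (auto simp: norm_divide)
      then show "z \<in> U"
        using seg[of "z / of_real r" r] r(2) ends_in_segment(2) by (metis subsetD)
    qed
  qed simp
  define r1 r2 where "r1 = 1 - \<epsilon>" and "r2 = 1 + \<epsilon>"
  have r1: "r1 > 0" "\<bar>r1 - 1\<bar> \<le> \<epsilon>" "r1 < 1" and r2: "r2 > 0" "\<bar>r2 - 1\<bar> \<le> \<epsilon>" "r2 > 1"
    using \<epsilon> by (auto simp: r1_def r2_def)
  obtain B1 where B1: "\<And>z. norm z = r1 \<Longrightarrow> norm (F z) \<le> B1"
    using compact_imp_bounded[OF sph[OF r1(1,2)]] unfolding bounded_iff by (metis imageI mem_sphere_0)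
  obtain B2 where B2: "\<And>z. norm z = r2 \<Longrightarrow> norm (F z) \<le> B2"
    using compact_imp_bounded[OF sph[OF r2(1,2)]] unfolding bounded_iff by (metis imageI mem_sphere_0)
  define B where "B = max \<bar>B1\<bar> \<bar>B2\<bar>"
  \<comment> \<open>The outer circle gives the rate \<open>inverse r2\<close> for
    \<open>n \<ge> 0\<close>, the inner one the rate \<open>r1\<close> for
    \<open>n < 0\<close>.\<close>
  define q where "q = max r1 (inverse r2)"
  have q: "0 < q" "q < 1" using r1 r2 by (auto simp: q_def inverse_less_1_iff)
  have fF: "(LINT z|circle. f z * z powi (- n)) = (LINT z|circle. F z * z powi (- n))" for n
  proof (rule integral_cong_AE)
    show "AE z in circle. f z * z powi (- n) = F z * z powi (- n)"
      using ae by eventually_elim simp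
  qed (intro borel_measurable_times borel_measurable_power_int borel_measurable_circle_id f
      borel_measurable_circle_continuous[OF Fc])+
  have coeff: "norm (fourier_coeff f n) \<le> x" if "norm (LINT z|circle. F z * z powi (- n)) \<le> 2 * pi * x" for n x
    using that by (simp add: fourier_coeff_def fF norm_divide pos_divide_le_eq mult_ac)
  have "norm (fourier_coeff f n) \<le> B * q ^ nat \<bar>n\<bar>" for n
  proof (cases "n \<ge> 0")
    case True
    have "norm (LINT z|circle. F z * z powi (- n)) \<le> 2 * pi * B * r2 powi (- n)"
      using seg r2 B2 by (intro norm_circle_integral_le[OF U(1,3)]) (auto simp: B_def le_max_iff_disj intro: order_trans[OF _ abs_ge_self])
    also have "\<dots> \<le> 2 * pi * B * q ^ nat \<bar>n\<bar>"
    proof (rule mult_left_mono)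
      have "r2 powi (- n) = inverse r2 ^ nat \<bar>n\<bar>"
        using True by (simp add: power_int_def power_inverse)
      also have "\<dots> \<le> q ^ nat \<bar>n\<bar>" using r2 by (intro power_mono) (auto simp: q_def)
      finally show "r2 powi (- n) \<le> q ^ nat \<bar>n\<bar>" .
    qed (simp add: B_def)
    finally show ?thesis by (intro coeff) (simp add: mult.assoc)
  next
    case False
    have "norm (LINT z|circle. F z * z powi (- n)) \<le> 2 * pi * B * r1 powi (- n)"
      using seg r1 B1 by (intro norm_circle_integral_le[OF U(1,3)]) (auto simp: B_def le_max_iff_disj intro: order_trans[OF _ abs_ge_self])
    also have "\<dots> \<le> 2 * pi * B * q ^ nat \<bar>n\<bar>"
    proof (rule mult_left_mono)
      have "r1 powi (- n) = r1 ^ nat \<bar>n\<bar>"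
        using False by (simp add: power_int_def)
      also have "\<dots> \<le> q ^ nat \<bar>n\<bar>" using r1 by (intro power_mono) (auto simp: q_def)
      finally show "r1 powi (- n) \<le> q ^ nat \<bar>n\<bar>" .
    qed (simp add: B_def)
    finally show ?thesis by (intro coeff) (simp add: mult.assoc)
  qed
  then have "\<exists>C q. 0 < q \<and> q < 1 \<and> (\<forall>n. norm (fourier_coeff f n) \<le> C * q ^ nat \<bar>n\<bar>)"
    using q by (intro exI[of _ B] exI[of _ q]) simp
  then show ?thesis by (rule that[OF Fc ae])
qed

section \<open>Uniqueness of Fourier coefficients for continuous functions\<close>

lemmas continuous_on_real_polynomial_function =
  continuous_on_polymonial_function[OF iffD1[OF real_polynomial_function_eq]]

text \<open>On the circle a real linear function is a combination of \<open>z\<close> and its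
  inverse, so multiplying by it only shifts indices. The induction keeps \<open>G\<close> arbitrary:
  for a product, the hypothesis for \<open>q\<close> is applied to \<open>G\<close> times
  \<open>p\<close>.\<close>

lemma circle_integral_polynomial_eq_0:
  fixes p :: "complex \<Rightarrow> real" and G :: "complex \<Rightarrow> complex"
  assumes "real_polynomial_function p"
    and "continuous_on (sphere 0 1) G" "\<And>n. (LINT z|circle. G z * z powi n) = 0"
  shows "(LINT z|circle. G z * of_real (p z) * z powi n) = 0"
  using assms
proof (induction p arbitrary: G n rule: real_polynomial_function.induct)
  case (linear p)
  note G = linear.prems
  interpret bounded_linear p by fact
  \<comment> \<open>From \<open>p z = Re z * p 1 + Im z * p \<i>\<close>, with the real and
    imaginary parts written through \<open>z\<close> and \<open>cnj z\<close>, the latter being the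
    inverse of \<open>z\<close>.\<close>
  have pz: "of_real (p z) = (of_real (p 1) / 2 - \<i> * of_real (p \<i>) / 2) * z powi 1 +
      (of_real (p 1) / 2 + \<i> * of_real (p \<i>) / 2) * z powi (- 1)" if "norm z = 1" for z
  proof -
    have "z = Re z *\<^sub>R 1 + Im z *\<^sub>R \<i>" by (simp add: complex_eq_iff)
    then have "p z = Re z * p 1 + Im z * p \<i>" by (metis add scaleR real_scaleR_def)
    moreover have zm: "z powi (- 1) = cnj z"
      using that by (metis complex_norm_square inverse_unique of_real_1 power_int_minus1_right power_one)
    ultimately show ?thesis
      unfolding power_int_1_right zm by (simp add: complex_eq_iff algebra_simps)
  qed
  let ?a = "of_real (p 1) / 2 - \<i> * of_real (p \<i>) / 2" and ?b = "of_real (p 1) / 2 + \<i> * of_real (p \<i>) / 2"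
  have int: "integrable circle (\<lambda>z. c * (G z * z powi m))" for m c
    by (intro integrable_circle_continuous continuous_intros G) auto
  have "(LINT z|circle. G z * of_real (p z) * z powi n) =
      (LINT z|circle. ?a * (G z * z powi (n + 1)) + ?b * (G z * z powi (n + (- 1))))"
  proof (rule Bochner_Integration.integral_cong[OF refl])
    fix z assume "z \<in> space circle"
    then have z: "norm z = 1" "z \<noteq> 0" by auto
    show "G z * of_real (p z) * z powi n =
        ?a * (G z * z powi (n + 1)) + ?b * (G z * z powi (n + (- 1)))"
      unfolding pz[OF z(1)] power_int_add[OF disjI1[OF z(2)]] by (simp add: algebra_simps del: power_int_1_right power_int_minus1_right)
  qed
  also have "\<dots> = ?a * (LINT z|circle. G z * z powi (n + 1)) + ?b * (LINT z|circle. G z * z powi (n + (- 1)))"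
    by (subst Bochner_Integration.integral_add[OF int int]) (simp only: integral_mult_right_zero)
  finally show ?case by (simp only: G) simp
next
  case (const c)
  have "(LINT z|circle. G z * of_real c * z powi n) = (LINT z|circle. of_real c * (G z * z powi n))"
    by (simp only: mult_ac)
  also have "\<dots> = of_real c * (LINT z|circle. G z * z powi n)"
    by (rule integral_mult_right_zero)
  finally show ?case using const by simp
next
  case (add p q)
  have int: "integrable circle (\<lambda>z. G z * of_real (p z) * z powi m)" if "real_polynomial_function p" for p m
    using that
    by (intro integrable_circle_continuous continuous_intros add
        continuous_on_real_polynomial_function) auto
  have "(LINT z|circle. G z * of_real (p z + q z) * z powi n) =
      (LINT z|circle. G z * of_real (p z) * z powi n + G z * of_real (q z) * z powi n)"
    by (simp add: algebra_simps)
  also have "\<dots> = 0"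
    by (subst Bochner_Integration.integral_add) (simp_all add: int add)
  finally show ?case .
next
  case (mult p q)
  have "(LINT z|circle. (G z * of_real (p z)) * of_real (q z) * z powi n) = 0"
    by (intro mult.IH(2) mult.IH(1) mult.prems continuous_intros
        continuous_on_real_polynomial_function mult.hyps)
  then show ?case by (simp add: mult_ac)
qed

text \<open>By Stone-Weierstrass a polynomial \<open>g\<close> approximates \<open>cnj (F z)\<close>
  uniformly. Since \<open>F z * g z\<close> integrates to \<open>0\<close>, the integral of
  \<open>F z * cnj (F z)\<close> is at most the error times the integral of
  \<open>norm (F z)\<close>, hence \<open>0\<close>.\<close>

lemma continuous_circle_eq_0:
  fixes F :: "complex \<Rightarrow> complex"
  assumes F: "continuous_on (sphere 0 1) F" and 0: "\<And>n. (LINT z|circle. F z * z powi n) = 0"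
  shows "AE z in circle. F z = 0"
proof -
  define I where "I = (LINT z|circle. norm (F z))"
  have cF: "continuous_on (sphere 0 1) (\<lambda>z. cnj (F z))" by (intro continuous_intros F)
  have Fi: "integrable circle (\<lambda>z. norm (F z))"
    using integrable_circle_continuous[OF F] by simp
  have S: "integrable circle (\<lambda>z. F z * cnj (F z))"
    by (intro integrable_circle_continuous continuous_intros F)
  have le: "norm (LINT z|circle. F z * cnj (F z)) \<le> e * I" if e: "e > 0" for e
  proof -
    obtain g where g: "polynomial_function g" "\<And>z. z \<in> sphere 0 1 \<Longrightarrow> norm (cnj (F z) - g z) < e"
      using Stone_Weierstrass_polynomial_function[OF compact_sphere cF e] by blast
    have p: "real_polynomial_function (\<lambda>z. Re (g z))" "real_polynomial_function (\<lambda>z. Im (g z))"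
      using g(1) bounded_linear_Re bounded_linear_Im unfolding polynomial_function_def o_def by auto
    have gc: "continuous_on (sphere 0 1) g"
      by (intro continuous_on_polymonial_function g)
    have ri: "integrable circle (\<lambda>z. F z * of_real (p z))" if "real_polynomial_function p" for p
      using that
      by (intro integrable_circle_continuous continuous_intros F continuous_on_real_polynomial_function)
    have Fg: "integrable circle (\<lambda>z. F z * (cnj (F z) - g z))"
      by (intro integrable_circle_continuous continuous_intros F gc)
    have Fg': "integrable circle (\<lambda>z. F z * g z)"
      by (intro integrable_circle_continuous continuous_intros F gc)
    have "(LINT z|circle. F z * g z) =
        (LINT z|circle. F z * of_real (Re (g z)) + \<i> * (F z * of_real (Im (g z))))"
    proof (rule Bochner_Integration.integral_cong[OF refl])
      fix z
      have "F z * g z = F z * (of_real (Re (g z)) + \<i> * of_real (Im (g z)))"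
        using complex_eq[of "g z"] by simp
      then show "F z * g z = F z * of_real (Re (g z)) + \<i> * (F z * of_real (Im (g z)))"
        by (simp add: algebra_simps)
    qed
    also have "\<dots> = (LINT z|circle. F z * of_real (Re (g z))) + \<i> * (LINT z|circle. F z * of_real (Im (g z)))"
      by (subst Bochner_Integration.integral_add) (simp_all add: ri p)
    also have "\<dots> = 0"
      using circle_integral_polynomial_eq_0[OF p(1) F 0, of 0]
        circle_integral_polynomial_eq_0[OF p(2) F 0, of 0] by simp
    finally have "(LINT z|circle. F z * g z) = 0" .
    moreover have "(LINT z|circle. F z * cnj (F z)) =
        (LINT z|circle. F z * (cnj (F z) - g z) + F z * g z)"
      by (simp add: algebra_simps)
    ultimately have "(LINT z|circle. F z * cnj (F z)) = (LINT z|circle. F z * (cnj (F z) - g z))"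
      by (simp add: Bochner_Integration.integral_add[OF Fg Fg'])
    also have "norm \<dots> \<le> (LINT z|circle. e * norm (F z))"
    proof (rule order_trans[OF integral_norm_bound integral_mono])
      show "norm (F z * (cnj (F z) - g z)) \<le> e * norm (F z)" if "z \<in> space circle" for z
        using g(2)[of z] that by (simp add: norm_mult mult.commute[of e] mult_left_mono)
    qed (use Fg Fi in auto)
    finally show ?thesis by (simp add: I_def)
  qed
  have I0: "I \<ge> 0" by (simp add: I_def)
  have "norm (LINT z|circle. F z * cnj (F z)) \<le> 0 + e" if "e > 0" for e
  proof -
    \<comment> \<open>Dividing by \<open>I + 1\<close> instead of \<open>I\<close> also covers
      \<open>I = 0\<close>.\<close>
    have "norm (LINT z|circle. F z * cnj (F z)) \<le> e / (I + 1) * I"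
      using that I0 by (intro le) auto
    also have "\<dots> \<le> e" using that I0 by (simp add: field_simps)
    finally show ?thesis by simp
  qed
  then have "norm (LINT z|circle. F z * cnj (F z)) \<le> 0" by (rule field_le_epsilon)
  then have "(LINT z|circle. complex_of_real ((norm (F z))\<^sup>2)) = 0"
    unfolding complex_norm_square by simp
  then have z: "(LINT z|circle. (norm (F z))\<^sup>2) = 0"
    by (simp only: integral_complex_of_real of_real_eq_0_iff)
  have "integrable circle (\<lambda>z. complex_of_real ((norm (F z))\<^sup>2))"
    using S unfolding complex_norm_square .
  then have "integrable circle (\<lambda>z. (norm (F z))\<^sup>2)"
    by (simp only: complex_of_real_integrable_eq)
  then have "AE z in circle. (norm (F z))\<^sup>2 = 0"
    using z by (subst (asm) integral_nonneg_eq_0_iff_AE) auto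
  then show ?thesis by simp
qed

section \<open>Null controls\<close>

lemma L2_imp_integrable:
  assumes "finite_measure M" and f: "f \<in> L2 M"
  shows "integrable M f"
proof -
  interpret finite_measure M by fact
  have "integrable M (\<lambda>x. 1 + (norm (f x))\<^sup>2)" using f by (simp add: L2_def)
  then show ?thesis
  proof (rule Bochner_Integration.integrable_bound)
    show "f \<in> borel_measurable M" using f by (simp add: L2_def)
    have "norm (f x) \<le> 1 + (norm (f x))\<^sup>2" for x
    proof -
      have "0 \<le> (norm (f x) - 1 / 2)\<^sup>2" by simp
      then show ?thesis by (simp add: power2_eq_square algebra_simps)
    qed
    then show "AE x in M. norm (f x) \<le> norm (1 + (norm (f x))\<^sup>2)" by (intro AE_I2) simp
  qed
qed

text \<open>An open interval is a countable union of compact ones, and continuous images of compact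
  sets are closed. This makes the arc a Borel set.\<close>

lemma open_strict_interval_imp_sets:
  assumes "open_strict_interval \<omega>"
  shows "\<omega> \<in> sets circle"
proof -
  obtain a b where \<omega>: "\<omega> = cis ` {a<..<b}"
    using assms by (auto simp: open_strict_interval_def)
  have "{a<..<b} = (\<Union>n. {a + 1 / real (Suc n)..b - 1 / real (Suc n)})"
  proof safe
    fix x assume x: "x \<in> {a<..<b}"
    then obtain n where "1 / real (Suc n) < min (x - a) (b - x)"
      using nat_approx_posE[of "min (x - a) (b - x)"] by auto
    then show "x \<in> (\<Union>n. {a + 1 / real (Suc n)..b - 1 / real (Suc n)})"
      by (intro UN_I[of n]) auto
  next
    fix x n assume x: "x \<in> {a + 1 / real (Suc n)..b - 1 / real (Suc n)}"
    have "0 < 1 / real (Suc n)" by simp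
    then show "x \<in> {a<..<b}" using x unfolding atLeastAtMost_iff greaterThanLessThan_iff by linarith
  qed
  then have eq: "\<omega> = (\<Union>n. cis ` {a + 1 / real (Suc n)..b - 1 / real (Suc n)})"
    unfolding \<omega> by (simp only: image_UN)
  have "cis ` {a + 1 / real (Suc n)..b - 1 / real (Suc n)} \<in> sets borel" for n
    by (intro borel_closed compact_imp_closed compact_continuous_image continuous_intros compact_Icc)
  then have "\<omega> \<in> sets borel" unfolding eq by blast
  moreover have "\<omega> \<subseteq> sphere 0 1" unfolding \<omega> by auto
  ultimately show ?thesis
    unfolding sets_circle by (simp add: sets_restrict_space_iff)
qed

text \<open>The point \<open>v\<close> is antipodal to the midpoint of the arc. A point at angle
  \<open>2 * y\<close> from the midpoint has distance \<open>\<bar>2 * cos y\<bar>\<close> from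
  \<open>v\<close>, and \<open>\<bar>y\<bar> \<le> (b - a) / 4 < pi / 2\<close>.\<close>

lemma open_strict_interval_avoids_point:
  assumes "open_strict_interval \<omega>"
  obtains v \<delta> where "norm v = 1" "\<delta> > 0" "\<And>w. w \<in> \<omega> \<Longrightarrow> \<delta> \<le> norm (w - v)"
proof -
  obtain a b where ab: "0 < b - a" "b - a < 2 * pi" and \<omega>: "\<omega> = cis ` {a<..<b}"
    using assms by (auto simp: open_strict_interval_def)
  define v where "v = - cis ((a + b) / 2)"
  have "2 * cos ((b - a) / 4) \<le> norm (w - v)" if w: "w \<in> \<omega>" for w
  proof -
    obtain x where x: "w = cis x" "x \<in> {a<..<b}" using w \<omega> by blast
    define y where "y = (x - (a + b) / 2) / 2"
    have "w = cis ((a + b) / 2) * cis y * cis y"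
      unfolding x y_def cis_mult by (simp add: field_simps)
    moreover have "1 = cis y * cis (- y)" by (simp add: cis_mult)
    ultimately have "w - v = cis ((a + b) / 2) * cis y * (cis y + cis (- y))"
      unfolding v_def by (simp add: algebra_simps)
    also have "cis y + cis (- y) = of_real (2 * cos y)"
      by (simp add: complex_eq_iff)
    finally have "norm (w - v) = \<bar>2 * cos y\<bar>" by (simp add: norm_mult abs_mult)
    moreover have "cos ((b - a) / 4) \<le> cos \<bar>y\<bar>"
    proof (rule cos_monotone_0_pi_le)
      show "\<bar>y\<bar> \<le> (b - a) / 4" using x(2) by (auto simp: y_def abs_le_iff field_simps)
    qed (use ab in auto)
    ultimately show ?thesis by simp
  qed
  moreover have "2 * cos ((b - a) / 4) > 0" using ab by (simp add: cos_gt_zero_pi)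
  moreover have "norm v = 1" by (simp add: v_def)
  ultimately show ?thesis using that by blast
qed

text \<open>For \<open>s < T\<close> the semigroup is a Poisson integral of radius
  \<open>exp (s - T)\<close>, and Fubini merges the two integrations. At \<open>s = T\<close> the
  semigroup is the identity while the kernel is \<open>0\<close>, but a single time is
  negligible.\<close>

lemma duhamel_integral_eq_poisson_integral:
  fixes u :: "real \<times> complex \<Rightarrow> complex" and T :: real and \<omega> :: "complex set"
  defines "N \<equiv> restrict_space lborel {0..T} \<Otimes>\<^sub>M restrict_space circle \<omega>"
  assumes \<omega>: "\<omega> \<in> sets circle" and u: "u \<in> borel_measurable N" and z: "norm z = 1"
    and int: "integrable N (\<lambda>p. u p * of_real (poisson_kernel (exp (fst p - T)) (z / snd p)))"
  shows "(LINT s:{0..T}|lborel. half_heat_semigroup (T - s) (extend_by_zero \<omega> (\<lambda>w. u (s, w))) z) =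
    (LINT p|N. u p * of_real (poisson_kernel (exp (fst p - T)) (z / snd p))) / (2 * pi)"
proof -
  define A where "A = restrict_space lborel {0..T}"
  define C where "C = restrict_space circle \<omega>"
  have N: "N = A \<Otimes>\<^sub>M C" by (simp add: N_def A_def C_def)
  interpret A: sigma_finite_measure A
    unfolding A_def by (intro sigma_finite_measure_restrict_space sigma_finite_lborel) simp
  interpret C: finite_measure C
    unfolding C_def by (intro finite_measure_restrict_space finite_measure_circle \<omega>)
  interpret pair_sigma_finite A C ..
  define H where "H s = half_heat_semigroup (T - s) (extend_by_zero \<omega> (\<lambda>w. u (s, w))) z" for s
  define R where "R s = (LINT w|C. u (s, w) * of_real (poisson_kernel (exp (s - T)) (z / w))) / (2 * pi)" for s
  have [measurable]: "u \<in> borel_measurable (A \<Otimes>\<^sub>M C)" using u N by simp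
  have [measurable]: "(\<lambda>s. s) \<in> borel_measurable A" "(\<lambda>w. w) \<in> borel_measurable C"
    unfolding A_def C_def by (rule measurable_restrict_space1; simp)+
  have HR: "H s = R s" if "s < T" for s
  proof -
    have "H s = (LINT w|circle. extend_by_zero \<omega> (\<lambda>w. u (s, w)) w *
        of_real (poisson_kernel (exp (s - T)) (z / w))) / (2 * pi)"
      unfolding H_def using half_heat_semigroup_eq_poisson_integral[of "T - s" z] that z by simp
    also have "(LINT w|circle. extend_by_zero \<omega> (\<lambda>w. u (s, w)) w *
        of_real (poisson_kernel (exp (s - T)) (z / w))) =
        (LINT w|C. u (s, w) * of_real (poisson_kernel (exp (s - T)) (z / w)))"
      unfolding C_def integral_restrict_space[OF sets.Int[OF \<omega> sets.top]]
      by (rule Bochner_Integration.integral_cong) (simp_all add: extend_by_zero_def)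
    finally show ?thesis by (simp add: R_def)
  qed
  have R: "R \<in> borel_measurable A" unfolding R_def by measurable
  \<comment> \<open>Measurability of \<open>H\<close> is inherited from \<open>R\<close>, from which
    it can differ only at the time \<open>T\<close>.\<close>
  have "(\<lambda>s. if s = T then H T else R s) \<in> borel_measurable A"
    using R by measurable
  then have H: "H \<in> borel_measurable A"
    by (rule measurable_cong[THEN iffD1, rotated]) (use HR in \<open>auto simp: A_def space_restrict_space\<close>)
  have "(LINT s:{0..T}|lborel. H s) = (LINT s|A. H s)"
    unfolding A_def set_lebesgue_integral_def by (subst integral_restrict_space) auto
  also have "\<dots> = (LINT s|A. R s)"
  proof (rule integral_cong_AE[OF H R])
    have "AE s in lborel. s \<noteq> T" by (rule AE_lborel_singleton)
    then show "AE s in A. H s = R s"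
      unfolding A_def by (subst AE_restrict_space_iff) (auto elim!: eventually_mono intro: HR)
  qed
  also have "\<dots> = (LINT s|A. LINT w|C. u (s, w) * of_real (poisson_kernel (exp (s - T)) (z / w))) / (2 * pi)"
    unfolding R_def by (rule integral_divide_zero)
  also have "(LINT s|A. LINT w|C. u (s, w) * of_real (poisson_kernel (exp (s - T)) (z / w))) =
      (LINT p|N. u p * of_real (poisson_kernel (exp (fst p - T)) (z / snd p)))"
    using integral_fst'[OF int[unfolded N]] by (simp add: N)
  finally show ?thesis by (simp add: H_def)
qed

lemma fst_snd_measurable:
  fixes A :: "real set"
  shows "fst \<in> borel_measurable (restrict_space lborel A \<Otimes>\<^sub>M restrict_space circle \<omega>)"
    and "snd \<in> borel_measurable (restrict_space lborel A \<Otimes>\<^sub>M restrict_space circle \<omega>)"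
proof -
  have "(\<lambda>s. s) \<in> borel_measurable (restrict_space lborel A)"
    by (rule measurable_restrict_space1) simp
  from measurable_compose[OF measurable_fst this]
  show "fst \<in> borel_measurable (restrict_space lborel A \<Otimes>\<^sub>M restrict_space circle \<omega>)" .
  have "(\<lambda>w. w) \<in> borel_measurable (restrict_space circle \<omega>)"
    by (rule measurable_restrict_space1) simp
  from measurable_compose[OF measurable_snd this]
  show "snd \<in> borel_measurable (restrict_space lborel A \<Otimes>\<^sub>M restrict_space circle \<omega>)" .
qed

text \<open>The vanishing final state is multiplied by \<open>z powi (- n)\<close> and integrated
  over the circle. The initial state then carries the factor
  \<open>exp (- T) ^ nat \<bar>n\<bar>\<close>, and the control at time \<open>s\<close> the factor
  \<open>exp (s - T) ^ nat \<bar>n\<bar>\<close>. Cancelling the common part leaves the growing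
  weight \<open>exp s ^ nat \<bar>n\<bar>\<close>.\<close>

lemma null_control_fourier_coeff:
  fixes u :: "real \<times> complex \<Rightarrow> complex" and T :: real and \<omega> :: "complex set"
  defines "N \<equiv> restrict_space lborel {0..T} \<Otimes>\<^sub>M restrict_space circle \<omega>"
  assumes \<omega>: "\<omega> \<in> sets circle" and T: "T > 0" and f: "integrable circle f" and u: "integrable N u"
    and 0: "AE z in circle. half_heat_solution \<omega> f u T z = 0"
  shows "(LINT p|N. (if fst p < T then u p else 0) *
      (of_real (exp (fst p)) ^ nat \<bar>n\<bar> * snd p powi (- n))) = - (2 * pi * fourier_coeff f n)"
proof -
  define A where "A = restrict_space lborel {0..T}"
  define C where "C = restrict_space circle \<omega>"
  have N: "N = A \<Otimes>\<^sub>M C" by (simp add: N_def A_def C_def)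
  interpret A: sigma_finite_measure A
    unfolding A_def by (intro sigma_finite_measure_restrict_space sigma_finite_lborel) simp
  interpret C: finite_measure C
    unfolding C_def by (intro finite_measure_restrict_space finite_measure_circle \<omega>)
  interpret AC: pair_sigma_finite A C ..
  interpret N: sigma_finite_measure N unfolding N by (rule AC.P.sigma_finite_measure_axioms)
  interpret NC: pair_sigma_finite N circle ..
  have [measurable]: "u \<in> borel_measurable N" "f \<in> borel_measurable circle" using u f by auto
  have [measurable]: "fst \<in> borel_measurable N" "snd \<in> borel_measurable N"
    unfolding N_def by (rule fst_snd_measurable)+
  have sp: "0 \<le> fst p" "fst p \<le> T" "norm (snd p) = 1" if "p \<in> space N" for p
    using that by (auto simp: N A_def C_def space_pair_measure space_restrict_space)
  let ?r = "\<lambda>p :: real \<times> complex. exp (fst p - T)"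
  let ?X = "\<lambda>z. LINT w|circle. f w * of_real (poisson_kernel (exp (- T)) (z / w))"
  let ?Y = "\<lambda>z. LINT p|N. u p * of_real (poisson_kernel (?r p) (z / snd p))"
  \<comment> \<open>Index \<open>0\<close> makes the character trivial. The joint integrability so
    obtained yields, for almost every \<open>z\<close>, the integrability over \<open>N\<close> that
    rewriting Duhamel's integral requires.\<close>
  have "integrable (N \<Otimes>\<^sub>M circle)
      (\<lambda>(p, z). z powi (- 0) * (u p * of_real (poisson_kernel (?r p) (z / snd p))))"
    by (rule integrable_poisson_kernel_pair) (use sp u in \<open>auto intro: N.sigma_finite_measure_axioms\<close>)
  then have "AE z in circle. integrable N (\<lambda>p. u p * of_real (poisson_kernel (?r p) (z / snd p)))"
    using NC.AE_integrable_snd[of "\<lambda>p z. u p * of_real (poisson_kernel (?r p) (z / snd p))"] by simp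
  with 0 AE_space[of circle] have XY: "AE z in circle. z powi (- n) * ?X z = - (z powi (- n) * ?Y z)"
  proof eventually_elim
    case (elim z)
    have "(LINT s:{0..T}|lborel. half_heat_semigroup (T - s) (extend_by_zero \<omega> (\<lambda>w. u (s, w))) z) =
        ?Y z / (2 * pi)"
      unfolding N_def
      by (rule duhamel_integral_eq_poisson_integral[OF \<omega>]) (use elim in \<open>auto simp flip: N_def\<close>)
    moreover have "half_heat_semigroup T f z = ?X z / (2 * pi)"
      by (rule half_heat_semigroup_eq_poisson_integral[OF T]) (use elim in auto)
    ultimately have "?X z / (2 * pi) + ?Y z / (2 * pi) = 0"
      using elim(1) by (simp add: half_heat_solution_def)
    then have "?X z = - ?Y z" by (simp add: field_simps add_eq_0_iff2)
    then show ?case by simp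
  qed
  have X: "(LINT z|circle. z powi (- n) * ?X z) =
      of_real (2 * pi * exp (- T) ^ nat \<bar>n\<bar>) * (2 * pi * fourier_coeff f n)"
  proof -
    have "(LINT z|circle. z powi (- n) * ?X z) = (LINT w|circle. (if exp (- T) < 1 then f w else 0) *
        (of_real (2 * pi * exp (- T) ^ nat \<bar>n\<bar>) * w powi (- n)))"
      by (rule fourier_integral_poisson[of circle f "\<lambda>w. w" "\<lambda>_. exp (- T)" n])
        (use f T in \<open>auto intro: circle.sigma_finite_measure_axioms\<close>)
    also have "\<dots> = (LINT w|circle. of_real (2 * pi * exp (- T) ^ nat \<bar>n\<bar>) * (f w * w powi (- n)))"
      using T by (simp add: mult_ac)
    also have "\<dots> = of_real (2 * pi * exp (- T) ^ nat \<bar>n\<bar>) * (LINT w|circle. f w * w powi (- n))"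
      by (rule integral_mult_right_zero)
    finally show ?thesis by (simp add: fourier_coeff_def)
  qed
  let ?I = "LINT p|N. (if fst p < T then u p else 0) * (of_real (exp (fst p)) ^ nat \<bar>n\<bar> * snd p powi (- n))"
  have Y: "(LINT z|circle. z powi (- n) * ?Y z) = of_real (2 * pi * exp (- T) ^ nat \<bar>n\<bar>) * ?I"
  proof -
    have "(LINT z|circle. z powi (- n) * ?Y z) = (LINT p|N. (if ?r p < 1 then u p else 0) *
        (of_real (2 * pi * ?r p ^ nat \<bar>n\<bar>) * snd p powi (- n)))"
      by (rule fourier_integral_poisson) (use sp u in \<open>auto intro: N.sigma_finite_measure_axioms\<close>)
    also have "\<dots> = (LINT p|N. of_real (2 * pi * exp (- T) ^ nat \<bar>n\<bar>) *
        ((if fst p < T then u p else 0) * (of_real (exp (fst p)) ^ nat \<bar>n\<bar> * snd p powi (- n))))"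
    proof (rule Bochner_Integration.integral_cong[OF refl])
      fix p :: "real \<times> complex"
      have "?r p = exp (- T) * exp (fst p)" by (simp flip: exp_add)
      then have "?r p ^ nat \<bar>n\<bar> = exp (- T) ^ nat \<bar>n\<bar> * exp (fst p) ^ nat \<bar>n\<bar>"
        by (simp only: power_mult_distrib)
      then show "(if ?r p < 1 then u p else 0) * (of_real (2 * pi * ?r p ^ nat \<bar>n\<bar>) * snd p powi (- n)) =
          of_real (2 * pi * exp (- T) ^ nat \<bar>n\<bar>) *
          ((if fst p < T then u p else 0) * (of_real (exp (fst p)) ^ nat \<bar>n\<bar> * snd p powi (- n)))"
        by simp
    qed
    also have "\<dots> = of_real (2 * pi * exp (- T) ^ nat \<bar>n\<bar>) * ?I"
      by (rule integral_mult_right_zero)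
    finally show ?thesis .
  qed
  have "(LINT z|circle. z powi (- n) * ?X z) = (LINT z|circle. - (z powi (- n) * ?Y z))"
  proof (rule integral_cong_AE[OF _ _ XY])
    show "(\<lambda>z. z powi (- n) * ?X z) \<in> borel_measurable circle" by measurable
    show "(\<lambda>z. - (z powi (- n) * ?Y z)) \<in> borel_measurable circle" by measurable
  qed
  then have "of_real (2 * pi * exp (- T) ^ nat \<bar>n\<bar>) * (2 * pi * fourier_coeff f n) =
      of_real (2 * pi * exp (- T) ^ nat \<bar>n\<bar>) * (- ?I)"
    using X Y by simp
  moreover have "complex_of_real (2 * pi * exp (- T) ^ nat \<bar>n\<bar>) \<noteq> 0" by simp
  ultimately have "2 * pi * fourier_coeff f n = - ?I"
    by (simp only: mult_cancel_left simp_thms)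
  then show ?thesis by simp
qed

section \<open>Vanishing of all Fourier coefficients of the initial state\<close>

theorem corollary1p13:
  fixes \<omega> :: "complex set" and T :: real and f\<^sub>0 :: "complex \<Rightarrow> complex"
  assumes "open_strict_interval \<omega>"
    and "T > 0"
    and "f\<^sub>0 \<in> L2 circle"
    and "analytic_on_circle f\<^sub>0"
    and "f\<^sub>0 \<in> null_controllable_L2 \<omega> T"
  shows "AE z in circle. f\<^sub>0 z = 0"
proof -
  define N where "N = restrict_space lborel {0..T} \<Otimes>\<^sub>M restrict_space circle \<omega>"
  have \<omega>: "\<omega> \<in> sets circle" using assms(1) by (rule open_strict_interval_imp_sets)
  have "finite_measure (restrict_space lborel {0..T})"
    by (rule finite_measureI) (use assms(2) in \<open>simp add: emeasure_restrict_space space_restrict_space\<close>)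
  then have N: "finite_measure N"
    unfolding N_def
    by (rule finite_measure_pair_measure[OF finite_measure_restrict_space[OF finite_measure_circle \<omega>]])
  obtain u where u: "u \<in> L2 N" and sol: "AE z in circle. half_heat_solution \<omega> f\<^sub>0 u T z = 0"
    using assms(5) unfolding null_controllable_L2_def N_def by blast
  have f: "integrable circle f\<^sub>0" by (rule L2_imp_integrable[OF finite_measure_circle assms(3)])
  have ui: "integrable N u" by (rule L2_imp_integrable[OF N u])
  define g where "g p = (if fst p < T then u p else 0)" for p
  note mom = null_control_fourier_coeff[OF \<omega> assms(2) f ui[unfolded N_def] sol, folded N_def, folded g_def]
  have [measurable]: "u \<in> borel_measurable N" using ui by simp
  have meas [measurable]: "fst \<in> borel_measurable N" "snd \<in> borel_measurable N"
    unfolding N_def by (rule fst_snd_measurable)+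
  have g: "integrable N g"
    by (rule Bochner_Integration.integrable_bound[OF ui]) (auto simp: g_def[abs_def])
  have sp: "0 \<le> fst p" "fst p \<le> T" "norm (snd p) = 1" "snd p \<in> \<omega>" if "p \<in> space N" for p
    using that by (auto simp: N_def space_pair_measure space_restrict_space)
  obtain F where F: "continuous_on (sphere 0 1) F" "AE z in circle. f\<^sub>0 z = F z"
    and "\<exists>C q. 0 < q \<and> q < 1 \<and> (\<forall>n. norm (fourier_coeff f\<^sub>0 n) \<le> C * q ^ nat \<bar>n\<bar>)"
    by (rule fourier_coeff_exponential_decay[OF assms(4) borel_measurable_integrable[OF f]])
  then obtain C q where q: "0 < q" "q < 1" and C: "\<And>n. norm (fourier_coeff f\<^sub>0 n) \<le> C * q ^ nat \<bar>n\<bar>"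
    by blast
  obtain v \<delta> where v: "norm v = 1" "\<delta> > 0" "\<And>w. w \<in> \<omega> \<Longrightarrow> \<delta> \<le> norm (w - v)"
    using open_strict_interval_avoids_point[OF assms(1)] by blast
  have bound: "norm (- (2 * pi * fourier_coeff f\<^sub>0 n)) \<le> (2 * pi * C) * q ^ nat \<bar>n\<bar>" for n
    using mult_left_mono[OF C[of n], of "2 * pi"] by (simp add: norm_mult mult_ac)
  \<comment> \<open>For \<open>n = int k\<close> the weight is the \<open>k\<close>-th power of
    \<open>exp s / w\<close>, for \<open>n = - int k\<close> that of \<open>exp s * w\<close>. Each
    half of the coefficients thus becomes a moment sequence with exponents in the naturals.\<close>
  have pos: "(LINT p|N. g p * (of_real (exp (fst p)) / snd p) ^ k) = - (2 * pi * fourier_coeff f\<^sub>0 (int k))" for k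
    using mom[of "int k"] by (simp add: power_mult_distrib power_inverse power_int_minus divide_inverse)
  have neg: "(LINT p|N. g p * (of_real (exp (fst p)) * snd p) ^ k) = - (2 * pi * fourier_coeff f\<^sub>0 (- int k))" for k
    using mom[of "- int k"] by (simp add: power_mult_distrib)
  \<comment> \<open>As \<open>inverse w = cnj w\<close> on the circle, the directions lie in the
    conjugate arc and stay away from \<open>cnj v\<close>. The moduli \<open>exp s\<close> lie
    between \<open>1\<close> and \<open>exp T\<close>.\<close>
  have pos0: "(LINT p|N. g p * (of_real (exp (fst p)) / snd p) ^ k) = 0" for k
  proof (rule moments_eq_0[OF g, where R = "exp T"])
    show "\<delta> \<le> norm (sgn (of_real (exp (fst p)) / snd p) - cnj v)" if p: "p \<in> space N" for p
    proof -
      have "inverse (snd p) = cnj (snd p)"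
        using sp(3)[OF p] by (metis complex_norm_square inverse_unique of_real_1 power_one)
      then have "sgn (of_real (exp (fst p)) / snd p) - cnj v = cnj (snd p - v)"
        using sp(3)[OF p] by (simp add: sgn_div_norm norm_divide norm_mult scaleR_conv_of_real divide_inverse)
      then show ?thesis using v(3)[OF sp(4)[OF p]] by (simp only: complex_mod_cnj)
    qed
    show "norm (LINT p|N. g p * (of_real (exp (fst p)) / snd p) ^ n) \<le> (2 * pi * C) * q ^ n" for n
      unfolding pos using bound[of "int n"] by simp
  qed (use v q sp in \<open>auto simp: norm_divide\<close>)
  have neg0: "(LINT p|N. g p * (of_real (exp (fst p)) * snd p) ^ k) = 0" for k
  proof (rule moments_eq_0[OF g, where R = "exp T"])
    show "\<delta> \<le> norm (sgn (of_real (exp (fst p)) * snd p) - v)" if p: "p \<in> space N" for p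
    proof -
      have "sgn (of_real (exp (fst p)) * snd p) = snd p"
        using sp(3)[OF p] by (simp add: sgn_div_norm norm_mult scaleR_conv_of_real)
      then show ?thesis using v(3)[OF sp(4)[OF p]] by simp
    qed
    show "norm (LINT p|N. g p * (of_real (exp (fst p)) * snd p) ^ n) \<le> (2 * pi * C) * q ^ n" for n
      unfolding neg using bound[of "- int n"] by simp
  qed (use v q sp in \<open>auto simp: norm_mult\<close>)
  have "fourier_coeff f\<^sub>0 n = 0" for n
    using pos[of "nat n"] pos0[of "nat n"] neg[of "nat (- n)"] neg0[of "nat (- n)"]
    by (cases "n \<ge> 0") auto
  moreover have [measurable]: "f\<^sub>0 \<in> borel_measurable circle" "F \<in> borel_measurable circle"
    using f borel_measurable_circle_continuous[OF F(1)] by auto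
  have "(LINT z|circle. f\<^sub>0 z * z powi n) = (LINT z|circle. F z * z powi n)" for n
  proof (rule integral_cong_AE)
    show "AE z in circle. f\<^sub>0 z * z powi n = F z * z powi n"
      using F(2) by eventually_elim simp
  qed measurable
  \<comment> \<open>Uniqueness was proved for continuous functions, hence the passage from
    \<open>f\<^sub>0\<close> to \<open>F\<close>. The exponent \<open>n\<close> belongs to the
    coefficient of index \<open>- n\<close>.\<close>
  ultimately have "(LINT z|circle. F z * z powi n) = 0" for n
    unfolding fourier_coeff_def by (metis add.inverse_inverse divide_eq_0_iff of_real_eq_0_iff
        mult_eq_0_iff pi_neq_zero zero_neq_numeral)
  then have "AE z in circle. F z = 0" by (rule continuous_circle_eq_0[OF F(1)])
  with F(2) show ?thesis by eventually_elim simp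
qed

end
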